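(* Let $d\ge 1$ and $n\ge 0$ be integers. For each $m\ge 0$ let $\{Y_\nu^m : 1\le \nu\le \sigma_m\}$ be an orthonormal basis of $\mathcal{H}_m^d$. Then a mutually orthogonal basis of $\mathcal{V}_n^d(\Delta)$ is given by the polynomials $$Q_{0,\nu}^n(x) = Y_\nu^n(x),\qquad 1\le \nu\le \sigma_n,$$ $$Q_{j,\nu}^n(x) = (1-\|x\|^2)\, P_{j-1}^{(2,\,n-2j+\frac{d-2}{2})}(2\|x\|^2-1)\, Y_\nu^{n-2j}(x),\qquad 1\le j\le \tfrac n2,\ 1\le \nu\le \sigma_{n-2j}.$$ Furthermore, $$\langle Q_{0,\nu}^n, Q_{0,\nu}^n\rangle_\Delta = \frac{2n+d}{d},\qquad \langle Q_{j,\nu}^n, Q_{j,\nu}^n\rangle_\Delta = \frac{8j^2(j+1)^2}{d\,(n+d/2)}\quad (1\le j\le \tfrac n2).$$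
   Context: $\|x\|$ is the Euclidean norm on $\mathbb{R}^d$, $B^d=\{x\in\mathbb{R}^d:\|x\|\le 1\}$, $S^{d-1}=\{x:\|x\|=1\}$, $d\omega$ is the surface measure on $S^{d-1}$ (counting measure if $d=1$), $\omega_{d-1}=2\pi^{d/2}/\Gamma(d/2)$ is the surface area of $S^{d-1}$, and $\operatorname{vol}(B^d)=\omega_{d-1}/d$. $\Delta$ is the usual Laplace operator on $\mathbb{R}^d$. $\Pi^d=\mathbb{R}[x_1,\dots,x_d]$ and $\Pi_n^d$ is the subspace of polynomials of total degree at most $n$. On $\Pi^d$ consider the inner product $$\langle f,g\rangle_\Delta=\frac{1}{4d^2\operatorname{vol}(B^d)}\int_{B^d}\Delta[(1-\|x\|^2)f(x)]\,\Delta[(1-\|x\|^2)g(x)]\,dx.$$ $\mathcal{V}_n^d(\Delta)$ is the space of $P\in\Pi_n^d$ that are orthogonal to all polynomials of degree less than $n$ with respect to $\langle\cdot,\cdot\rangle_\Delta$. A basis $\{P_\alpha\}$ of $\mathcal{V}_n^d(\Delta)$ is called mutually orthogonal if $\langle P_\alpha,P_\beta\rangle_\Delta=0$ whenever $\alpha\neq\beta$. $\mathcal{H}_m^d$ is the space of homogeneous polynomials $Y$ of degree $m$ in $d$ variables with $\Delta Y=0$, and $\sigma_m=\dim\mathcal{H}_m^d$. Orthonormality of $\{Y_\nu^m\}$ means $\frac{1}{\omega_{d-1}}\int_{S^{d-1}}Y_\mu^m(x')Y_\nu^m(x')\,d\omega(x')=\delta_{\mu,\nu}$. $P_j^{(\alpha,\beta)}$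 ($\alpha,\beta>-1$) is the Jacobi polynomial of degree $j$, orthogonal with respect to $(1-s)^\alpha(1+s)^\beta$ on $[-1,1]$, with the standard normalization $P_j^{(\alpha,\beta)}(1)=\binom{j+\alpha}{j}$.
   Formalization: The squared norm of Q_{j,ν}^n for j ≥ 1 is proved to be 2j²(j+1)²/(d(n+d/2)); the printed factor 8 is wrong: for d=1, n=2, j=1, Q=±(1−x²) has squared norm 16/5, not 64/5. *)

theory Defs
  imports
    "HOL-Analysis.Analysis"
    "HOL-Library.Function_Algebras"
    "HOL-Computational_Algebra.Polynomial"
begin

section \<open>The real vector space of functions\<close>

text \<open>
  Since \<^typ>\<open>real\<close> is infinite, polynomials in \<open>d = CARD('d)\<close> real variables are identified with
  the functions they induce on \<^typ>\<open>real^'d\<close>.  The pointwise vector space structure below makes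
  \<^const>\<open>span\<close>, \<^const>\<open>independent\<close> and \<^const>\<open>dim\<close> available for sets of such functions.
\<close>

instantiation "fun" :: (type, scaleR) scaleR
begin
definition "c *\<^sub>R f = (\<lambda>x. c *\<^sub>R f x)"
instance ..
end

lemma scaleR_fun_apply [simp]: "(c *\<^sub>R f) x = c *\<^sub>R f x"
  by (simp add: scaleR_fun_def)

instance "fun" :: (type, real_vector) real_vector
  by standard (simp_all add: fun_eq_iff scaleR_add_right scaleR_add_left)

definition is_basis_family :: "'i set \<Rightarrow> ('i \<Rightarrow> 'v::real_vector) \<Rightarrow> 'v set \<Rightarrow> bool" where
  "is_basis_family I b V \<longleftrightarrow> inj_on b I \<and> independent (b ` I) \<and> span (b ` I) = V"


section \<open>Polynomials and spherical harmonics\<close>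

definition monomial_fun :: "('d::finite \<Rightarrow> nat) \<Rightarrow> real^'d \<Rightarrow> real" where
  "monomial_fun k x = (\<Prod>i\<in>UNIV. (x $ i) ^ k i)"

definition poly_space :: "nat \<Rightarrow> (real^'d::finite \<Rightarrow> real) set" where
  "poly_space n = span {monomial_fun k |k. (\<Sum>i\<in>UNIV. k i) \<le> n}"

definition homogeneous_space :: "nat \<Rightarrow> (real^'d::finite \<Rightarrow> real) set" where
  "homogeneous_space m = span {monomial_fun k |k. (\<Sum>i\<in>UNIV. k i) = m}"

definition partial_deriv :: "'d \<Rightarrow> (real^'d::finite \<Rightarrow> real) \<Rightarrow> real^'d \<Rightarrow> real" where
  "partial_deriv i f x = deriv (\<lambda>t. f (x + t *\<^sub>R axis i 1)) 0"

definition laplacian :: "(real^'d::finite \<Rightarrow> real) \<Rightarrow> real^'d \<Rightarrow> real" where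
  "laplacian f x = (\<Sum>i\<in>UNIV. partial_deriv i (partial_deriv i f) x)"

definition harmonic_space :: "nat \<Rightarrow> (real^'d::finite \<Rightarrow> real) set" where
  "harmonic_space m = {Y \<in> homogeneous_space m. \<forall>x. laplacian Y x = 0}"


section \<open>Surface measure on the unit sphere\<close>

text \<open>
  The surface measure of a Borel set \<open>A\<close> of the sphere is \<open>d\<close> times the volume of the cone
  \<open>{r x | 0 < r \<le> 1, x \<in> A}\<close>, which is the preimage of \<open>A\<close> in the punctured ball under
  \<open>sgn x = x / \<parallel>x\<parallel>\<close>.  For \<open>d = 1\<close> this is the counting measure on the two points of the sphere.
\<close>

definition surface_measure :: "(real^'d::finite) measure" where
  "surface_measure =
     scale_measure (of_nat CARD('d))
       (distr (restrict_space lborel (cball 0 1 - {0})) (restrict_space borel (sphere 0 1)) sgn)"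

definition sphere_area :: "nat \<Rightarrow> real" where
  "sphere_area d = 2 * pi powr (real d / 2) / Gamma (real d / 2)"

lemma sgn_measurable_sphere:
  "(sgn :: real^'d::finite \<Rightarrow> _) \<in>
     restrict_space lborel (cball 0 1 - {0}) \<rightarrow>\<^sub>M restrict_space borel (sphere 0 1)"
proof (rule measurable_restrict_space2)
  show "sgn \<in> space (restrict_space lborel (cball 0 1 - {0})) \<rightarrow> sphere (0::real^'d) 1"
    by (auto simp: space_restrict_space norm_sgn)
  have "(\<lambda>x::real^'d. x /\<^sub>R norm x) \<in> borel_measurable borel"
    by measurable
  then show "(sgn :: real^'d \<Rightarrow> _) \<in> restrict_space lborel (cball 0 1 - {0}) \<rightarrow>\<^sub>M borel"
    by (intro measurable_restrict_space1) (simp add: sgn_div_norm[abs_def])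
qed

lemma emeasure_surface_measure:
  assumes "A \<in> sets borel" "A \<subseteq> sphere (0::real^'d::finite) 1"
  shows "emeasure surface_measure A =
           of_nat CARD('d) * emeasure lborel {r *\<^sub>R x |r x. 0 < r \<and> r \<le> 1 \<and> x \<in> A}"
proof -
  let ?P = "cball (0::real^'d) 1 - {0}"
  have eq: "sgn -` A \<inter> ?P = {r *\<^sub>R x |r x. 0 < r \<and> r \<le> 1 \<and> x \<in> A}"
  proof (intro equalityI subsetI)
    fix y assume y: "y \<in> sgn -` A \<inter> ?P"
    then have "y = norm y *\<^sub>R sgn y" by (simp add: sgn_div_norm)
    with y show "y \<in> {r *\<^sub>R x |r x. 0 < r \<and> r \<le> 1 \<and> x \<in> A}"
      by (intro CollectI exI[of _ "norm y"] exI[of _ "sgn y"]) auto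
  next
    fix y assume "y \<in> {r *\<^sub>R x |r x. 0 < r \<and> r \<le> 1 \<and> x \<in> A}"
    then obtain r x where "y = r *\<^sub>R x" "0 < r" "r \<le> 1" "x \<in> A" by blast
    with assms show "y \<in> sgn -` A \<inter> ?P"
      by (auto simp: sgn_scaleR sgn_div_norm subset_iff)
  qed
  have A: "A \<in> sets (restrict_space borel (sphere (0::real^'d) 1))"
    using assms by (auto simp: sets_restrict_space image_iff)
  have "emeasure surface_measure A = of_nat CARD('d) *
      emeasure (restrict_space lborel ?P) (sgn -` A \<inter> ?P)"
    unfolding surface_measure_def
    by (simp add: emeasure_distr[OF sgn_measurable_sphere A] space_restrict_space)
  also have "emeasure (restrict_space lborel ?P) (sgn -` A \<inter> ?P) = emeasure lborel (sgn -` A \<inter> ?P)"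
    by (rule emeasure_restrict_space) auto
  finally show ?thesis by (simp only: eq)
qed

lemma measure_surface_measure_sphere:
  "measure surface_measure (sphere (0::real^'d::finite) 1) = sphere_area CARD('d)"
proof -
  let ?P = "cball (0::real^'d) 1 - {0}"
  have A: "sphere (0::real^'d) 1 \<in> sets (restrict_space borel (sphere (0::real^'d) 1))"
    by (auto simp: sets_restrict_space image_iff intro: exI[of _ UNIV])
  have pre: "sgn -` sphere (0::real^'d) 1 \<inter> ?P = ?P"
    by (auto simp: norm_sgn)
  have "emeasure lborel ?P = emeasure lborel (cball (0::real^'d) 1)"
    by (subst emeasure_Diff) (auto simp: emeasure_cball)
  then have "emeasure surface_measure (sphere (0::real^'d) 1) =
      of_nat CARD('d) * ennreal (unit_ball_vol CARD('d))"
    unfolding surface_measure_def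
    by (simp add: emeasure_distr[OF sgn_measurable_sphere A] space_restrict_space pre
        emeasure_restrict_space emeasure_cball)
  also have "\<dots> = ennreal (CARD('d) * unit_ball_vol CARD('d))"
    by (simp add: ennreal_mult ennreal_of_nat_eq_real_of_nat)
  also have "CARD('d) * unit_ball_vol CARD('d) = sphere_area CARD('d)"
  proof -
    have "real CARD('d) / 2 \<notin> \<int>\<^sub>\<le>\<^sub>0"
      using nonpos_Ints_nonpos[of "real CARD('d) / 2"] by auto
    note Gamma_plus1[OF this]
    then show ?thesis
      unfolding unit_ball_vol_def sphere_area_def by (simp only:) simp
  qed
  finally show ?thesis
    by (simp add: measure_def sphere_area_def)
qed

definition sphere_inner :: "(real^'d::finite \<Rightarrow> real) \<Rightarrow> (real^'d \<Rightarrow> real) \<Rightarrow> real" where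
  "sphere_inner f g = 1 / sphere_area CARD('d) * (LINT x|surface_measure. f x * g x)"


section \<open>The Sobolev inner product and its orthogonal polynomials\<close>

definition sobolev_inner :: "(real^'d::finite \<Rightarrow> real) \<Rightarrow> (real^'d \<Rightarrow> real) \<Rightarrow> real" where
  "sobolev_inner f g =
     1 / (4 * (real CARD('d))\<^sup>2 * measure lborel (cball (0::real^'d) 1)) *
     (LINT x:cball 0 1|lborel.
        laplacian (\<lambda>y. (1 - (norm y)\<^sup>2) * f y) x * laplacian (\<lambda>y. (1 - (norm y)\<^sup>2) * g y) x)"

definition orthogonal_space :: "nat \<Rightarrow> (real^'d::finite \<Rightarrow> real) set" where
  "orthogonal_space n =
     {P \<in> poly_space n. \<forall>k<n. \<forall>q\<in>poly_space k. sobolev_inner P q = 0}"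


section \<open>Jacobi polynomials\<close>

text \<open>The two conditions determine the polynomial uniquely when \<open>a > -1\<close> and \<open>b > -1\<close>.\<close>

definition jacobi_poly :: "real \<Rightarrow> real \<Rightarrow> nat \<Rightarrow> real poly" where
  "jacobi_poly a b j = (THE p. degree p = j \<and>
     (\<forall>q. degree q < j \<longrightarrow>
        (LINT s:{-1..1}|lborel. (1 - s) powr a * (1 + s) powr b * poly p s * poly q s) = 0) \<and>
     poly p 1 = (real j + a) gchoose j)"

text \<open>
  With \<open>b = n - 2j + (d-2)/2\<close> one has, for \<open>j \<ge> 1\<close>,
  \<open>\<Delta>[(1 - \<parallel>x\<parallel>\<^sup>2) Q\<^sub>j] = \<plusminus> 4 j (j+1) P\<^sub>j\<^sup>(\<^sup>0\<^sup>,\<^sup>b\<^sup>)(2\<parallel>x\<parallel>\<^sup>2 - 1) Y\<close>, and the integral over the ball of the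
  square of \<open>P\<^sub>j\<^sup>(\<^sup>0\<^sup>,\<^sup>b\<^sup>) Y\<close> is \<open>\<omega>\<^sub>d\<^sub>-\<^sub>1 / (2 (n + d/2))\<close>.  Dividing by \<open>4 d\<^sup>2 vol = 4 d \<omega>\<^sub>d\<^sub>-\<^sub>1\<close>, the squared norm of \<open>Q\<^sub>j\<close>
  is \<open>2 j\<^sup>2 (j+1)\<^sup>2 / (d (n + d/2))\<close>.  The source prints the factor \<open>8\<close> instead of \<open>2\<close>, which is a slip:
  for \<open>d = 1\<close>, \<open>n = 2\<close>, \<open>j = 1\<close> the squared norm is that of \<open>1 - x\<^sup>2\<close>, i.e. \<open>1/8\<close> times the integral of
  \<open>(12 x\<^sup>2 - 4)\<^sup>2\<close> over \<open>[-1,1]\<close>, which is \<open>16/5\<close> and not \<open>64/5\<close>.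
\<close>

definition sobolev_Q ::
    "(nat \<Rightarrow> nat \<Rightarrow> real^'d::finite \<Rightarrow> real) \<Rightarrow> nat \<Rightarrow> nat \<Rightarrow> nat \<Rightarrow> real^'d \<Rightarrow> real" where
  "sobolev_Q Y n j \<nu> x =
     (if j = 0 then Y n \<nu> x
      else (1 - (norm x)\<^sup>2) *
           poly (jacobi_poly 2 (real n - 2 * real j + (real CARD('d) - 2) / 2) (j - 1))
             (2 * (norm x)\<^sup>2 - 1) *
           Y (n - 2 * j) \<nu> x)"

end

theory Submission
  imports Defs
begin

text \<open>
  Everything rests on the operator \<open>T f = \<Delta>[(1 - |x|^2) f]\<close>, since the Sobolev inner product of \<open>f\<close> and
  \<open>g\<close> is a multiple of the integral of \<open>T f * T g\<close> over the ball.  On functions of the form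
  \<open>g(|x|^2) Y(x)\<close> with \<open>Y\<close> harmonic and homogeneous of degree \<open>k\<close> the Laplacian acts on the radial
  factor alone: with \<open>t = |x|^2\<close> and \<open>b = k + (d - 2)/2\<close> it replaces \<open>g\<close> by \<open>L g = 4 (t g'' + (b + 1) g')\<close>
  (\<open>laplacian_radial\<close>).  Both kinds of basis polynomials have this form, so \<open>T\<close> sends the
  polynomial with index \<open>j\<close> to \<open>f_j(|x|^2) Y(x)\<close> for a polynomial \<open>f_j\<close> of degree at most \<open>j\<close> in one
  variable.

  The integral over the ball of a radial polynomial times \<open>Y Z\<close> factors into a one-dimensional moment
  with weight \<open>t^b\<close> on \<open>[0,1]\<close> and the integral of \<open>Y Z\<close> over the sphere
  (\<open>integral_ball_radial_homogeneous\<close>).  Harmonics of different degrees are orthogonal on the sphere;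
  this is Green's identity, applied on the ball with the weight \<open>1 - |x|^2\<close>, which removes the boundary
  terms (\<open>integral_ball_harmonic_orthogonal\<close>).  What is left is a statement in one variable: the \<open>f_j\<close>
  are orthogonal for the weight \<open>t^b\<close>, with known norms.

  That statement needs no explicit formula for Jacobi polynomials.  For \<open>j \<ge> 1\<close> one has \<open>f_j = L g\<close> with
  \<open>g = (1 - t)^2 P(2t - 1)\<close> and \<open>P\<close> the Jacobi polynomial with parameters \<open>2, b\<close> and degree \<open>j - 1\<close>.
  The double zero of \<open>g\<close> at \<open>1\<close> makes \<open>L\<close> symmetric when applied to \<open>g\<close>, and \<open>L\<close> lowers degrees by
  one; so the orthogonality of \<open>P\<close> for the weight \<open>(1 - t)^2 t^b\<close> turns into orthogonality of \<open>f_j\<close> for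
  \<open>t^b\<close> (\<open>radial_image_orthogonal\<close>).  The norms come from integrating the derivative of
  \<open>t^(b+1) f^2\<close>: for \<open>f\<close> of degree at most \<open>j\<close> orthogonal to all smaller degrees this gives
  \<open>(2j + b + 1) M = f(1)^2\<close> for the moment \<open>M\<close> of \<open>f^2\<close>, and \<open>f_j(1) = 8 P(1) = 4 j (j + 1)\<close>.  For \<open>j = 0\<close> the
  image \<open>f_0\<close> is the constant \<open>-4 (b + 1)\<close>.

  Finally, every homogeneous polynomial is a sum of terms \<open>|x|^(2i) Z\<close> with \<open>Z\<close> harmonic
  (\<open>homogeneous_eq_harmonic_multiples\<close>), and the radial factors have degrees \<open>0, 1, 2, ...\<close>; hence the
  basis polynomials of all degrees up to \<open>n\<close> together span the polynomials of degree at most \<open>n\<close>.  Since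
  they are mutually orthogonal with positive norms, those of degree exactly \<open>n\<close> span precisely the
  polynomials orthogonal to all lower degrees.
\<close>

section \<open>Differential calculus of polynomial functions\<close>

definition polyfuns :: "(real^'d::finite \<Rightarrow> real) set" where
  "polyfuns = span (range monomial_fun)"

lemma subspace_polyfuns: "subspace polyfuns"
  by (simp add: polyfuns_def)

lemma poly_space_subset_polyfuns: "poly_space n \<subseteq> polyfuns"
  unfolding poly_space_def polyfuns_def by (rule span_mono) auto

lemma homogeneous_subset_poly_space:
  assumes "m \<le> n" shows "homogeneous_space m \<subseteq> poly_space n"
  unfolding homogeneous_space_def poly_space_def using assms by (intro span_mono) auto

lemma homogeneous_subset_polyfuns: "homogeneous_space m \<subseteq> polyfuns"
  using homogeneous_subset_poly_space poly_space_subset_polyfuns by blast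

lemma harmonic_subset_homogeneous: "harmonic_space m \<subseteq> homogeneous_space m"
  by (auto simp: harmonic_space_def)

text \<open>
  Bilinearity, in the form that reduces a statement on products of polynomials to products of
  generators.
\<close>

lemma span_mult:
  fixes f g :: "'a \<Rightarrow> real"
  assumes f: "f \<in> span S" and g: "g \<in> span T"
    and ST: "\<And>a b. a \<in> S \<Longrightarrow> b \<in> T \<Longrightarrow> (\<lambda>x. a x * b x) \<in> span U"
  shows "(\<lambda>x. f x * g x) \<in> span U"
proof -
  have "(\<lambda>x. a x * g x) \<in> span U" if a: "a \<in> S" for a
    using g
  proof (induction rule: span_induct_alt)
    case base
    have "(\<lambda>x. a x * (0::'a \<Rightarrow> real) x) = 0" by (simp add: fun_eq_iff)
    then show ?case by (metis span_zero)
  next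
    case (step c b h)
    have "(\<lambda>x. a x * (c *\<^sub>R b + h) x) = c *\<^sub>R (\<lambda>x. a x * b x) + (\<lambda>x. a x * h x)"
      by (simp add: fun_eq_iff algebra_simps)
    then show ?case using ST[OF a step(1)] step(2) by (metis span_add span_scale)
  qed
  with f show ?thesis
  proof (induction rule: span_induct_alt)
    case base
    have "(\<lambda>x. (0::'a \<Rightarrow> real) x * g x) = 0" by (simp add: fun_eq_iff)
    then show ?case by (metis span_zero)
  next
    case (step c b h)
    have "(\<lambda>x. (c *\<^sub>R b + h) x * g x) = c *\<^sub>R (\<lambda>x. b x * g x) + (\<lambda>x. h x * g x)"
      by (simp add: fun_eq_iff algebra_simps)
    with step show ?case by (metis span_add span_scale)
  qed
qed

lemma monomial_fun_mult:
  "monomial_fun k x * monomial_fun l x = monomial_fun (\<lambda>i. k i + l i) x"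
  by (simp add: monomial_fun_def power_add prod.distrib)

lemma polyfuns_mult:
  assumes "f \<in> polyfuns" "g \<in> polyfuns" shows "(\<lambda>x. f x * g x) \<in> polyfuns"
  using assms unfolding polyfuns_def
  by (rule span_mult) (auto simp: monomial_fun_mult intro: span_base)

lemma homogeneous_mult:
  assumes "f \<in> homogeneous_space m" "g \<in> homogeneous_space n"
  shows "(\<lambda>x. f x * g x) \<in> homogeneous_space (m + n)"
  using assms unfolding homogeneous_space_def
  by (rule span_mult) (auto simp: monomial_fun_mult sum.distrib intro!: span_base)

lemma homogeneous_coord: "(\<lambda>x::real^'d::finite. x $ i) \<in> homogeneous_space 1"
proof -
  have "(\<lambda>x::real^'d. x $ i) = monomial_fun (\<lambda>j. if j = i then 1 else 0)"
    by (simp add: monomial_fun_def fun_eq_iff if_distrib[of "\<lambda>n. _ ^ n"] prod.delta cong: if_cong)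
  then show ?thesis unfolding homogeneous_space_def
    by (auto intro!: span_base exI[of _ "\<lambda>j. if j = i then 1 else 0"])
qed

lemma homogeneous_const: "(\<lambda>x::real^'d::finite. c) \<in> homogeneous_space 0"
proof -
  have "(\<lambda>x::real^'d. c) = c *\<^sub>R monomial_fun (\<lambda>j. 0)"
    by (simp add: monomial_fun_def fun_eq_iff)
  moreover have "c *\<^sub>R monomial_fun (\<lambda>j. 0) \<in> homogeneous_space 0"
    unfolding homogeneous_space_def by (intro span_scale span_base) auto
  ultimately show ?thesis by (metis (no_types))
qed

lemma norm_sq_coords: "(norm (x::real^'d::finite))\<^sup>2 = (\<Sum>i\<in>UNIV. x $ i * x $ i)"
  by (simp add: norm_vec_def L2_set_def power2_eq_square sum_nonneg real_sqrt_pow2)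

lemma sum_fun_apply: "(\<Sum>i\<in>A. f i) x = (\<Sum>i\<in>A. f i x)" for f :: "'i \<Rightarrow> 'a \<Rightarrow> real"
  by (induction A rule: infinite_finite_induct) auto

lemma homogeneous_norm_sq: "(\<lambda>x::real^'d::finite. (norm x)\<^sup>2) \<in> homogeneous_space 2"
proof -
  have "(\<lambda>x::real^'d. (norm x)\<^sup>2) = (\<Sum>i\<in>UNIV. (\<lambda>x. x $ i * x $ i))"
    by (simp add: fun_eq_iff sum_fun_apply norm_sq_coords)
  also have "\<dots> \<in> homogeneous_space (1 + 1)"
    unfolding homogeneous_space_def
    by (intro span_sum homogeneous_mult[OF homogeneous_coord homogeneous_coord, unfolded homogeneous_space_def])
  finally show ?thesis by (simp add: numeral_2_eq_2)
qed

lemma polyfuns_const: "(\<lambda>x. c) \<in> polyfuns"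
  using homogeneous_const homogeneous_subset_polyfuns by blast

lemma polyfuns_coord: "(\<lambda>x. x $ i) \<in> polyfuns"
  using homogeneous_coord homogeneous_subset_polyfuns by blast

lemma polyfuns_norm_sq: "(\<lambda>x. (norm x)\<^sup>2) \<in> polyfuns"
  using homogeneous_norm_sq homogeneous_subset_polyfuns by blast

lemma polyfuns_add: "f \<in> polyfuns \<Longrightarrow> g \<in> polyfuns \<Longrightarrow> (\<lambda>x. f x + g x) \<in> polyfuns"
  using subspace_add[OF subspace_polyfuns, of f g] by (simp add: plus_fun_def)

lemma polyfuns_cmult: "f \<in> polyfuns \<Longrightarrow> (\<lambda>x. c * f x) \<in> polyfuns"
  by (intro polyfuns_mult polyfuns_const)

lemma polyfuns_diff: "f \<in> polyfuns \<Longrightarrow> g \<in> polyfuns \<Longrightarrow> (\<lambda>x. f x - g x) \<in> polyfuns"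
  using subspace_diff[OF subspace_polyfuns, of f g] by (simp add: fun_diff_def)

lemmas polyfuns_intros = polyfuns_const polyfuns_coord polyfuns_norm_sq polyfuns_add
  polyfuns_cmult polyfuns_diff polyfuns_mult

lemma polyfuns_poly_norm_sq: "(\<lambda>x. poly p ((norm x)\<^sup>2)) \<in> polyfuns"
  by (induction p) (auto intro!: polyfuns_intros)

lemma monomial_fun_has_partial_deriv:
  "((\<lambda>t. monomial_fun k (x + t *\<^sub>R axis i 1)) has_real_derivative
      real (k i) * monomial_fun (k(i := k i - 1)) x) (at 0)"
proof -
  let ?R = "\<Prod>j\<in>UNIV - {i}. (x $ j) ^ k j"
  have split: "monomial_fun l y = (y $ i) ^ l i * (\<Prod>j\<in>UNIV - {i}. (y $ j) ^ l j)" for l and y :: "real^'a"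
    unfolding monomial_fun_def by (rule prod.remove) auto
  have "(\<Prod>j\<in>UNIV - {i}. ((x + t *\<^sub>R axis i 1) $ j) ^ k j) = ?R" for t
    by (rule prod.cong) (auto simp: axis_def)
  then have eq: "monomial_fun k (x + t *\<^sub>R axis i 1) = (x $ i + t) ^ k i * ?R" for t
    unfolding split[of k] by (simp add: axis_def)
  have "(\<Prod>j\<in>UNIV - {i}. (x $ j) ^ (k(i := k i - 1)) j) = ?R"
    by (rule prod.cong) auto
  then have eq': "monomial_fun (k(i := k i - 1)) x = (x $ i) ^ (k i - 1) * ?R"
    unfolding split[of "k(i := k i - 1)"] by simp
  show ?thesis unfolding eq eq'
    by (auto intro!: derivative_eq_intros)
qed

lemma partial_deriv_monomial:
  "partial_deriv i (monomial_fun k) = (real (k i)) *\<^sub>R monomial_fun (k(i := k i - 1))"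
proof (rule ext)
  fix x
  show "partial_deriv i (monomial_fun k) x = (real (k i) *\<^sub>R monomial_fun (k(i := k i - 1))) x"
    unfolding partial_deriv_def DERIV_imp_deriv[OF monomial_fun_has_partial_deriv] by simp
qed

lemma polyfun_differentiable:
  assumes "f \<in> polyfuns"
  shows "(\<lambda>t. f (x + t *\<^sub>R axis i 1)) differentiable (at 0)"
  using assms unfolding polyfuns_def
proof (induction rule: span_induct_alt)
  case (step c a g)
  then obtain k where k: "a = monomial_fun k" by blast
  have "(\<lambda>t. a (x + t *\<^sub>R axis i 1)) differentiable (at 0)"
    using monomial_fun_has_partial_deriv[of k x i] unfolding k real_differentiable_def by blast
  with step(2) show ?case by simp
qed (simp add: zero_fun_def)

lemma polyfun_has_partial_deriv:
  assumes "f \<in> polyfuns"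
  shows "((\<lambda>t. f (x + t *\<^sub>R axis i 1)) has_real_derivative partial_deriv i f x) (at 0)"
  unfolding partial_deriv_def
  using polyfun_differentiable[OF assms] DERIV_deriv_iff_real_differentiable by blast

text \<open>
  The derivative along a coordinate line at an arbitrary parameter, as the mean value theorem needs it.
\<close>

lemma polyfun_has_partial_deriv_at:
  assumes "f \<in> polyfuns"
  shows "((\<lambda>t. f (x + t *\<^sub>R axis i 1)) has_real_derivative partial_deriv i f (x + s *\<^sub>R axis i 1)) (at s)"
proof -
  have "((\<lambda>t. f (x + (t + s) *\<^sub>R axis i 1)) has_real_derivative partial_deriv i f (x + s *\<^sub>R axis i 1)) (at 0)"
    using polyfun_has_partial_deriv[OF assms, of "x + s *\<^sub>R axis i 1" i]
    by (simp add: algebra_simps)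
  then show ?thesis
    using DERIV_shift[of "\<lambda>t. f (x + t *\<^sub>R axis i 1)" _ 0 s] by simp
qed

lemma partial_deriv_add:
  assumes "f \<in> polyfuns" "g \<in> polyfuns"
  shows "partial_deriv i (\<lambda>x. f x + g x) = (\<lambda>x. partial_deriv i f x + partial_deriv i g x)"
proof (rule ext)
  fix x
  show "partial_deriv i (\<lambda>x. f x + g x) x = partial_deriv i f x + partial_deriv i g x"
    by (subst partial_deriv_def)
       (intro DERIV_imp_deriv DERIV_add polyfun_has_partial_deriv assms)
qed

lemma partial_deriv_mult:
  assumes "f \<in> polyfuns" "g \<in> polyfuns"
  shows "partial_deriv i (\<lambda>x. f x * g x) = (\<lambda>x. partial_deriv i f x * g x + f x * partial_deriv i g x)"
proof (rule ext)
  fix x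
  show "partial_deriv i (\<lambda>x. f x * g x) x = partial_deriv i f x * g x + f x * partial_deriv i g x"
    using DERIV_imp_deriv[OF DERIV_mult[OF polyfun_has_partial_deriv[OF assms(1)]
        polyfun_has_partial_deriv[OF assms(2)]], of x i]
    by (simp add: partial_deriv_def[of i "\<lambda>x. f x * g x"] mult.commute)
qed

lemma partial_deriv_const: "partial_deriv i (\<lambda>x. c) = (\<lambda>x. 0)"
  by (simp add: partial_deriv_def fun_eq_iff)

lemma partial_deriv_zero: "partial_deriv i 0 = 0"
  unfolding zero_fun_def by (rule partial_deriv_const)

lemma partial_deriv_cmult:
  assumes "f \<in> polyfuns"
  shows "partial_deriv i (\<lambda>x. c * f x) = (\<lambda>x. c * partial_deriv i f x)"
  using partial_deriv_mult[OF polyfuns_const assms, of i c] by (simp add: partial_deriv_const)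

lemma partial_deriv_coord: "partial_deriv i (\<lambda>x::real^'d::finite. x $ j) = (\<lambda>x. if i = j then 1 else 0)"
  unfolding partial_deriv_def fun_eq_iff
  by (auto intro!: DERIV_imp_deriv derivative_eq_intros simp: axis_def)

lemma partial_deriv_norm_sq: "partial_deriv i (\<lambda>x::real^'d::finite. (norm x)\<^sup>2) = (\<lambda>x. 2 * x $ i)"
proof (rule ext)
  fix x :: "real^'d"
  have eq: "(norm (x + t *\<^sub>R axis i 1))\<^sup>2 = (norm x)\<^sup>2 + 2 * t * x $ i + t\<^sup>2" for t
    unfolding power2_norm_eq_inner
    by (simp add: inner_add_left inner_add_right inner_axis' inner_axis
        algebra_simps power2_eq_square inner_axis_axis del: power2_norm_eq_inner)
  show "partial_deriv i (\<lambda>x::real^'d. (norm x)\<^sup>2) x = 2 * x $ i"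
    unfolding partial_deriv_def eq by (rule DERIV_imp_deriv) (auto intro!: derivative_eq_intros)
qed

lemma partial_deriv_span:
  fixes f :: "real^'d::finite \<Rightarrow> real"
  assumes "f \<in> span S" "S \<subseteq> polyfuns" and S: "\<And>s. s \<in> S \<Longrightarrow> partial_deriv i s \<in> span T"
  shows "partial_deriv i f \<in> span T"
proof -
  have "f \<in> polyfuns \<and> partial_deriv i f \<in> span T"
    using assms(1)
  proof (induction rule: span_induct_alt)
    case base
    show ?case unfolding partial_deriv_zero
      using subspace_0[OF subspace_polyfuns] span_zero by blast
  next
    case (step c a g)
    then have a: "a \<in> polyfuns" and g: "g \<in> polyfuns" using assms(2) by auto
    have "c *\<^sub>R a + g = (\<lambda>x. c * a x + g x)" by (simp add: fun_eq_iff)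
    moreover have "partial_deriv i (\<lambda>x. c * a x + g x) = c *\<^sub>R partial_deriv i a + partial_deriv i g"
      using a g by (simp add: partial_deriv_add partial_deriv_cmult polyfuns_cmult fun_eq_iff)
    moreover have "c *\<^sub>R partial_deriv i a + partial_deriv i g \<in> span T"
      using S[OF step(1)] step(2) by (intro span_add span_scale) auto
    ultimately show ?case using polyfuns_add[OF polyfuns_cmult[OF a] g, of c] by metis
  qed
  then show ?thesis ..
qed

lemma polyfuns_partial_deriv:
  assumes "f \<in> polyfuns" shows "partial_deriv i f \<in> polyfuns"
  using assms unfolding polyfuns_def
proof (rule partial_deriv_span)
  fix s :: "real^'a \<Rightarrow> real" assume "s \<in> range monomial_fun"
  then show "partial_deriv i s \<in> span (range monomial_fun)"
    unfolding polyfuns_def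
    by (elim rangeE, simp only: partial_deriv_monomial, intro span_scale span_base rangeI)
qed (auto simp: polyfuns_def intro: span_base)

text \<open>
  For \<open>m = 0\<close> the truncated degree \<open>m - 1\<close> is \<open>0\<close>, which is harmless because the derivative vanishes.
\<close>

lemma homogeneous_partial_deriv:
  assumes "f \<in> homogeneous_space m" shows "partial_deriv i f \<in> homogeneous_space (m - 1)"
  using assms unfolding homogeneous_space_def
proof (rule partial_deriv_span)
  fix s :: "real^'a \<Rightarrow> real" assume "s \<in> {monomial_fun k |k. sum k UNIV = m}"
  then obtain k where k: "s = monomial_fun k" "sum k UNIV = m" by blast
  show "partial_deriv i s \<in> span {monomial_fun k |k. sum k UNIV = m - 1}"
  proof (cases "k i = 0")
    case True
    then show ?thesis by (simp add: k partial_deriv_monomial span_zero)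
  next
    case False
    have "sum (k(i := k i - 1)) UNIV = m - 1"
      using False k(2) by (simp add: sum.remove[of UNIV i])
    then show ?thesis unfolding k partial_deriv_monomial by (intro span_scale span_base) blast
  qed
qed (auto simp: polyfuns_def intro: span_base)

lemma laplacian_add:
  assumes "f \<in> polyfuns" "g \<in> polyfuns"
  shows "laplacian (\<lambda>x. f x + g x) x = laplacian f x + laplacian g x"
  using assms by (simp add: laplacian_def partial_deriv_add polyfuns_partial_deriv sum.distrib)

lemma laplacian_cmult:
  assumes "f \<in> polyfuns"
  shows "laplacian (\<lambda>x. c * f x) x = c * laplacian f x"
  using assms by (simp add: laplacian_def partial_deriv_cmult polyfuns_partial_deriv sum_distrib_left)

lemma laplacian_diff:
  assumes "f \<in> polyfuns" "g \<in> polyfuns"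
  shows "laplacian (\<lambda>x. f x - g x) x = laplacian f x - laplacian g x"
  using laplacian_add[OF assms(1) polyfuns_cmult[OF assms(2), of "-1"], of x]
  by (simp add: laplacian_cmult[OF assms(2), of "-1", simplified])

lemma polyfuns_sum:
  "(\<And>i. i \<in> A \<Longrightarrow> f i \<in> polyfuns) \<Longrightarrow> (\<lambda>x. \<Sum>i\<in>A. f i x) \<in> polyfuns"
  by (induction A rule: infinite_finite_induct) (auto intro!: polyfuns_intros)

lemma polyfuns_laplacian: "f \<in> polyfuns \<Longrightarrow> laplacian f \<in> polyfuns"
  unfolding laplacian_def[abs_def] by (intro polyfuns_sum polyfuns_partial_deriv)

lemma homogeneous_laplacian:
  assumes "f \<in> homogeneous_space m" shows "laplacian f \<in> homogeneous_space (m - 2)"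
proof -
  have "laplacian f = (\<Sum>i\<in>UNIV. partial_deriv i (partial_deriv i f))"
    by (simp add: fun_eq_iff laplacian_def sum_fun_apply)
  also have "\<dots> \<in> homogeneous_space (m - 1 - 1)"
    unfolding homogeneous_space_def
    by (intro span_sum homogeneous_partial_deriv[unfolded homogeneous_space_def]
        assms[unfolded homogeneous_space_def])
  finally show ?thesis by (simp add: numeral_2_eq_2)
qed

definition euler :: "(real^'d::finite \<Rightarrow> real) \<Rightarrow> real^'d \<Rightarrow> real" where
  "euler f x = (\<Sum>i\<in>UNIV. x $ i * partial_deriv i f x)"

lemma euler_add:
  assumes "f \<in> polyfuns" "g \<in> polyfuns"
  shows "euler (\<lambda>x. f x + g x) x = euler f x + euler g x"
  using assms by (simp add: euler_def partial_deriv_add distrib_left sum.distrib)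

lemma euler_cmult:
  assumes "f \<in> polyfuns"
  shows "euler (\<lambda>x. c * f x) x = c * euler f x"
  using assms by (simp add: euler_def partial_deriv_cmult sum_distrib_left mult.left_commute)

lemma euler_homogeneous:
  assumes "f \<in> homogeneous_space m" shows "euler f x = real m * f x"
proof -
  have "f \<in> polyfuns \<and> euler f x = real m * f x"
    using assms unfolding homogeneous_space_def
  proof (induction rule: span_induct_alt)
    case base
    show ?case
      unfolding euler_def partial_deriv_zero
      by (intro conjI subspace_0[OF subspace_polyfuns]) simp
  next
    case (step c a g)
    then obtain k where k: "a = monomial_fun k" "sum k UNIV = m" by blast
    have a: "a \<in> polyfuns" by (auto simp: k polyfuns_def intro: span_base)
    have *: "x $ i * partial_deriv i a x = real (k i) * a x" for i
    proof (cases "k i = 0")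
      case False
      have "x $ i * monomial_fun (k(i := k i - 1)) x = monomial_fun k x"
        unfolding monomial_fun_def using False
        by (subst (1 2) prod.remove[of UNIV i]) (simp_all add: power_eq_if)
      then show ?thesis by (simp add: k partial_deriv_monomial)
    qed (simp add: k partial_deriv_monomial)
    have ea: "euler a x = real m * a x"
      unfolding euler_def * by (simp add: k(2)[symmetric] sum_distrib_right)
    have eq: "c *\<^sub>R a + g = (\<lambda>x. c * a x + g x)" by (simp add: fun_eq_iff)
    have "euler (\<lambda>x. c * a x + g x) x = c * euler a x + euler g x"
      using a step(2) by (simp add: euler_add euler_cmult polyfuns_cmult)
    then show ?case unfolding eq using step(2) a ea
      by (auto simp: algebra_simps intro!: polyfuns_add polyfuns_cmult)
  qed
  then show ?thesis ..
qed

lemma homogeneous_scaling: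
  assumes "f \<in> homogeneous_space m" shows "f (c *\<^sub>R x) = c ^ m * f x"
  using assms unfolding homogeneous_space_def
proof (induction rule: span_induct_alt)
  case (step a g h)
  then obtain k where k: "g = monomial_fun k" "sum k UNIV = m" by blast
  have "g (c *\<^sub>R x) = c ^ m * g x"
    by (simp add: k(1) monomial_fun_def power_mult_distrib prod.distrib k(2)[symmetric] power_sum)
  with step show ?case by (simp add: algebra_simps)
qed simp

lemma euler_norm_sq_mult:
  assumes "f \<in> polyfuns"
  shows "euler (\<lambda>x. (norm x)\<^sup>2 * f x) x = (norm x)\<^sup>2 * (2 * f x + euler f x)"
proof -
  have "euler (\<lambda>x. (norm x)\<^sup>2 * f x) x =
      (\<Sum>i\<in>UNIV. 2 * f x * (x $ i * x $ i) + (norm x)\<^sup>2 * (x $ i * partial_deriv i f x))"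
    unfolding euler_def partial_deriv_mult[OF polyfuns_norm_sq assms] partial_deriv_norm_sq
    by (simp add: algebra_simps)
  also have "\<dots> = 2 * f x * (norm x)\<^sup>2 + (norm x)\<^sup>2 * euler f x"
    by (simp only: sum.distrib sum_distrib_left[symmetric] norm_sq_coords[symmetric] euler_def)
  finally show ?thesis by (simp add: algebra_simps)
qed

lemma laplacian_norm_sq_mult:
  fixes x :: "real^'d::finite"
  assumes f: "f \<in> polyfuns"
  shows "laplacian (\<lambda>x. (norm x)\<^sup>2 * f x) x =
    (norm x)\<^sup>2 * laplacian f x + 4 * euler f x + 2 * real CARD('d) * f x"
proof -
  have "partial_deriv i (partial_deriv i (\<lambda>x. (norm x)\<^sup>2 * f x)) x =
      2 * f x + 4 * (x $ i * partial_deriv i f x) + (norm x)\<^sup>2 * partial_deriv i (partial_deriv i f) x" for i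
    using f by (simp add: partial_deriv_mult partial_deriv_add partial_deriv_const partial_deriv_coord
        partial_deriv_norm_sq polyfuns_intros polyfuns_partial_deriv algebra_simps)
  then show ?thesis
    by (simp add: laplacian_def euler_def sum.distrib sum_distrib_left)
qed

lemma polyfun_continuous: "f \<in> polyfuns \<Longrightarrow> continuous_on UNIV f"
  unfolding polyfuns_def
proof (induction rule: span_induct_alt)
  case (step c a g)
  have "continuous_on UNIV (monomial_fun k)" for k
    unfolding monomial_fun_def[abs_def] by (intro continuous_intros)
  with step have "continuous_on UNIV (\<lambda>x. c * a x + g x)" by (auto intro!: continuous_intros)
  moreover have "c *\<^sub>R a + g = (\<lambda>x. c * a x + g x)" by (simp add: fun_eq_iff)
  ultimately show ?case by simp
qed (simp add: zero_fun_def)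

section \<open>Radial multiples of harmonic polynomials\<close>

text \<open>
  The Laplacian in the variable \<open>t = |x|^2\<close>: the operator \<open>g \<mapsto> 4 (t g'' + (b + 1) g')\<close>, equal to
  \<open>4 t^(-b) (t^(b+1) g')'\<close> and therefore formally symmetric for the weight \<open>t^b\<close>.
\<close>

definition radial_laplacian :: "real \<Rightarrow> real poly \<Rightarrow> real poly" where
  "radial_laplacian b g = smult 4 ([:0, 1:] * pderiv (pderiv g) + smult (b + 1) (pderiv g))"

text \<open>
  The exponent \<open>b\<close> for which \<open>t^b\<close> is the radial weight of \<open>|Y|^2\<close>, \<open>Y\<close> of degree \<open>k\<close>: in polar
  coordinates \<open>r^(2k + d - 1) dr = t^b dt / 2\<close>.  The type argument only carries the dimension.
\<close>

definition radial_index :: "nat \<Rightarrow> 'd::finite itself \<Rightarrow> real" where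
  "radial_index k _ = real k + (real CARD('d) - 2) / 2"

lemma radial_index_gt: "radial_index k TYPE('d::finite) > -1"
proof -
  have "0 < real CARD('d)" "0 \<le> real k" by simp_all
  then show ?thesis unfolding radial_index_def by (simp add: field_simps add_pos_nonneg)
qed

lemma polyfuns_radial: "Y \<in> polyfuns \<Longrightarrow> (\<lambda>x. poly g ((norm x)\<^sup>2) * Y x) \<in> polyfuns"
  by (intro polyfuns_mult polyfuns_poly_norm_sq)

lemma radial_pCons:
  "(\<lambda>x. poly (pCons a g) ((norm x)\<^sup>2) * Y x) =
   (\<lambda>x. a * Y x + (norm x)\<^sup>2 * (poly g ((norm x)\<^sup>2) * Y x))"
  by (simp add: fun_eq_iff algebra_simps)

lemma euler_radial:
  assumes Y: "Y \<in> homogeneous_space k"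
  shows "euler (\<lambda>x. poly g ((norm x)\<^sup>2) * Y x) x =
    (real k * poly g ((norm x)\<^sup>2) + 2 * (norm x)\<^sup>2 * poly (pderiv g) ((norm x)\<^sup>2)) * Y x"
proof (induction g)
  case 0
  have "euler (\<lambda>x::real^'a. 0) x = 0" by (simp add: euler_def partial_deriv_const)
  then show ?case by simp
next
  case (pCons a g)
  have Yp: "Y \<in> polyfuns" using Y homogeneous_subset_polyfuns by blast
  then have f: "(\<lambda>x. poly g ((norm x)\<^sup>2) * Y x) \<in> polyfuns" by (rule polyfuns_radial)
  have "euler (\<lambda>x. poly (pCons a g) ((norm x)\<^sup>2) * Y x) x =
      a * euler Y x + (norm x)\<^sup>2 * (2 * (poly g ((norm x)\<^sup>2) * Y x) +
        euler (\<lambda>x. poly g ((norm x)\<^sup>2) * Y x) x)"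
    unfolding radial_pCons
    by (simp add: euler_add euler_cmult polyfuns_cmult Yp f polyfuns_mult[OF polyfuns_norm_sq f]
        euler_norm_sq_mult[OF f])
  then show ?case
    unfolding pCons.IH euler_homogeneous[OF Y] by (simp add: pderiv_pCons algebra_simps)
qed

text \<open>
  Induction on the coefficients of \<open>g\<close>, one factor \<open>|x|^2\<close> at a time.  Multiplying by \<open>|x|^2\<close> adds
  \<open>4 (x \<cdot> \<nabla>) + 2d\<close> to the Laplacian, and the Euler operator of the smaller product is known from
  \<open>euler_radial\<close>.
\<close>

lemma laplacian_radial:
  fixes Y :: "real^'d::finite \<Rightarrow> real"
  assumes Y: "Y \<in> harmonic_space k"
  shows "laplacian (\<lambda>x. poly g ((norm x)\<^sup>2) * Y x) x =
    poly (radial_laplacian (radial_index k TYPE('d)) g) ((norm x)\<^sup>2) * Y x"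
proof (induction g)
  case 0
  have "laplacian (\<lambda>x::real^'d. 0) x = 0" by (simp add: laplacian_def partial_deriv_const)
  then show ?case by (simp add: radial_laplacian_def)
next
  case (pCons a g)
  have Yh: "Y \<in> homogeneous_space k" and L: "laplacian Y x = 0"
    using Y by (auto simp: harmonic_space_def)
  then have Yp: "Y \<in> polyfuns" using homogeneous_subset_polyfuns by blast
  then have f: "(\<lambda>x. poly g ((norm x)\<^sup>2) * Y x) \<in> polyfuns" by (rule polyfuns_radial)
  have "laplacian (\<lambda>x. poly (pCons a g) ((norm x)\<^sup>2) * Y x) x =
      (norm x)\<^sup>2 * laplacian (\<lambda>x. poly g ((norm x)\<^sup>2) * Y x) x +
      4 * euler (\<lambda>x. poly g ((norm x)\<^sup>2) * Y x) x +
      2 * real CARD('d) * (poly g ((norm x)\<^sup>2) * Y x)"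
    unfolding radial_pCons
    by (simp add: laplacian_add laplacian_cmult polyfuns_cmult Yp f polyfuns_mult[OF polyfuns_norm_sq f]
        laplacian_norm_sq_mult[OF f] L)
  also have "\<dots> = poly (radial_laplacian (radial_index k TYPE('d)) (pCons a g)) ((norm x)\<^sup>2) * Y x"
    unfolding pCons.IH euler_radial[OF Yh]
    by (simp add: radial_laplacian_def radial_index_def pderiv_pCons pderiv_add diff_divide_distrib algebra_simps)
  finally show ?case .
qed

lemma radial_laplacian_monom:
  "radial_laplacian b (monom c (Suc i)) = monom (4 * c * (real i + 1) * (real i + 1 + b)) i"
proof -
  have X: "[:0, 1:] = monom (1::real) 1" by (simp add: monom_Suc)
  show ?thesis unfolding radial_laplacian_def X
    by (cases i) (simp_all add: pderiv_monom mult_monom smult_monom add_monom algebra_simps)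
qed

section \<open>Decomposition into harmonic components\<close>

lemma homogeneous_norm_power:
  assumes "Z \<in> homogeneous_space k"
  shows "(\<lambda>x. ((norm x)\<^sup>2) ^ i * Z x) \<in> homogeneous_space (k + 2 * i)"
proof (induction i)
  case (Suc i)
  have "(\<lambda>x. (norm x)\<^sup>2 * (((norm x)\<^sup>2) ^ i * Z x)) \<in> homogeneous_space (2 + (k + 2 * i))"
    by (intro homogeneous_mult homogeneous_norm_sq Suc)
  then show ?case by (simp add: mult.assoc)
qed (use assms in simp)

lemma radial_poly_space:
  assumes Z: "Z \<in> homogeneous_space k" and g: "k + 2 * degree g \<le> n"
  shows "(\<lambda>x. poly g ((norm x)\<^sup>2) * Z x) \<in> poly_space n"
proof -
  have "(\<lambda>x. poly g ((norm x)\<^sup>2) * Z x) = (\<Sum>i\<le>degree g. coeff g i *\<^sub>R (\<lambda>x. ((norm x)\<^sup>2) ^ i * Z x))"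
    by (simp add: fun_eq_iff sum_fun_apply poly_altdef sum_distrib_right mult.assoc)
  also have "\<dots> \<in> poly_space n"
    unfolding poly_space_def
  proof (intro span_sum span_scale)
    fix i assume "i \<in> {..degree g}"
    then have "k + 2 * i \<le> n" using g by simp
    from homogeneous_subset_poly_space[OF this] homogeneous_norm_power[OF Z, of i]
    show "(\<lambda>x. ((norm x)\<^sup>2) ^ i * Z x) \<in> span {monomial_fun k |k. sum k UNIV \<le> n}"
      unfolding poly_space_def by blast
  qed
  finally show ?thesis .
qed

definition harmonic_multiples :: "nat \<Rightarrow> (real^'d::finite \<Rightarrow> real) set" where
  "harmonic_multiples n =
     {\<lambda>x. ((norm x)\<^sup>2) ^ i * Z x |i k Z. Z \<in> harmonic_space k \<and> k + 2 * i = n}"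

lemma harmonic_multiples_span_homogeneous: "span (harmonic_multiples n) \<subseteq> homogeneous_space n"
proof (rule span_minimal)
  show "harmonic_multiples n \<subseteq> homogeneous_space n"
    using harmonic_subset_homogeneous by (auto simp: harmonic_multiples_def intro!: homogeneous_norm_power)
  show "subspace (homogeneous_space n)" by (simp add: homogeneous_space_def)
qed

text \<open>
  The Laplacian sends \<open>|x|^(2i+2) Z\<close> to \<open>4 (i + 1)(i + 1 + b) |x|^(2i) Z\<close>, and the factor is positive
  because \<open>b > -1\<close>; so each generator has a preimage.
\<close>

lemma laplacian_surj_harmonic_multiples:
  fixes f :: "real^'d::finite \<Rightarrow> real"
  assumes "f \<in> span (harmonic_multiples m)"
  shows "\<exists>q \<in> span (harmonic_multiples (m + 2)). \<forall>x. laplacian q x = f x"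
  using assms
proof (induction rule: span_induct_alt)
  case base
  show ?case
  proof (intro bexI allI)
    show "laplacian 0 x = (0 :: real^'d \<Rightarrow> real) x" for x
      unfolding laplacian_def partial_deriv_zero by simp
  qed (rule span_zero)
next
  case (step c a g)
  then obtain q where q: "q \<in> span (harmonic_multiples (m + 2))" "\<And>x. laplacian q x = g x" by blast
  from step obtain i k Z where a: "a = (\<lambda>x. ((norm x)\<^sup>2) ^ i * Z x)"
    and Z: "Z \<in> harmonic_space k" and m: "k + 2 * i = m"
    by (auto simp: harmonic_multiples_def)
  define b where "b = radial_index k TYPE('d)"
  define e where "e = 4 * (real i + 1) * (real i + 1 + b)"
  have "e > 0" using radial_index_gt[of k, where 'd = 'd] by (simp add: e_def b_def add_nonneg_pos)
  define r where "r = (\<lambda>x. ((norm x)\<^sup>2) ^ Suc i * Z x)"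
  have r: "r \<in> span (harmonic_multiples (m + 2))"
    unfolding r_def harmonic_multiples_def using Z m by (intro span_base) fastforce
  have Lr: "laplacian r x = e * a x" for x
    using laplacian_radial[OF Z, of "monom 1 (Suc i)" x, folded b_def]
    unfolding radial_laplacian_monom by (simp add: poly_monom r_def a e_def)
  have pol: "q \<in> polyfuns" "r \<in> polyfuns"
    using q(1) r harmonic_multiples_span_homogeneous homogeneous_subset_polyfuns by blast+
  let ?q = "\<lambda>x. c / e * r x + q x"
  have eq: "?q = (c / e) *\<^sub>R r + q" by (simp add: fun_eq_iff)
  show ?case
  proof
    show "?q \<in> span (harmonic_multiples (m + 2))"
      unfolding eq using q(1) r by (intro span_add span_scale)
    have "laplacian ?q x = c / e * (e * a x) + g x" for x
      unfolding laplacian_add[OF polyfuns_cmult[OF pol(2)] pol(1)] laplacian_cmult[OF pol(2)] q(2) Lr ..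
    then show "\<forall>x. laplacian ?q x = (c *\<^sub>R a + g) x" using \<open>e > 0\<close> by simp
  qed
qed

lemma homogeneous_0_partial_deriv:
  assumes "f \<in> homogeneous_space 0" shows "partial_deriv i f = 0"
proof -
  have "partial_deriv i f \<in> span {}"
    using assms unfolding homogeneous_space_def
    by (rule partial_deriv_span)
       (auto simp only: polyfuns_def partial_deriv_monomial intro: span_base, simp)
  then show ?thesis by simp
qed

text \<open>
  By induction \<open>\<Delta> p\<close> is already a combination of terms \<open>|x|^(2i) Z\<close>, and it is the Laplacian of a
  combination \<open>q\<close> of such terms of degree \<open>n\<close>.  Then \<open>p - q\<close> is harmonic and homogeneous, and
  \<open>p = (p - q) + q\<close>.
\<close>

lemma homogeneous_eq_harmonic_multiples:
  "homogeneous_space n = span (harmonic_multiples n)"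
proof (rule antisym[OF _ harmonic_multiples_span_homogeneous], rule subsetI)
  fix p :: "real^'d::finite \<Rightarrow> real"
  assume "p \<in> homogeneous_space n"
  then show "p \<in> span (harmonic_multiples n)"
  proof (induction n arbitrary: p rule: less_induct)
    case (less n)
    have harm: "h \<in> span (harmonic_multiples n)" if "h \<in> homogeneous_space n" "\<And>x. laplacian h x = 0" for h
    proof (rule span_base)
      have "h = (\<lambda>x. ((norm x)\<^sup>2) ^ 0 * h x)" by simp
      then show "h \<in> harmonic_multiples n"
        using that unfolding harmonic_multiples_def harmonic_space_def by force
    qed
    show ?case
    proof (cases "n < 2")
      case True
      have "partial_deriv i (partial_deriv i p) = 0" for i
      proof (rule homogeneous_0_partial_deriv)
        show "partial_deriv i p \<in> homogeneous_space 0"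
          using homogeneous_partial_deriv[OF less.prems, of i] True by (simp add: less_2_cases_iff)
      qed
      then have "laplacian p x = 0" for x by (simp add: laplacian_def)
      then show ?thesis by (intro harm less.prems)
    next
      case False
      then have "laplacian p \<in> span (harmonic_multiples (n - 2))"
        by (intro less.IH homogeneous_laplacian less.prems) auto
      from laplacian_surj_harmonic_multiples[OF this] False
      obtain q where q: "q \<in> span (harmonic_multiples n)" "\<And>x. laplacian q x = laplacian p x"
        by (auto simp del: One_nat_def add_2_eq_Suc')
      have qh: "q \<in> homogeneous_space n" using q(1) harmonic_multiples_span_homogeneous by blast
      have "p - q \<in> span (harmonic_multiples n)"
      proof (rule harm)
        show "p - q \<in> homogeneous_space n"
          using less.prems qh unfolding homogeneous_space_def by (rule span_diff)
        have "p \<in> polyfuns" "q \<in> polyfuns" using less.prems qh homogeneous_subset_polyfuns by blast+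
        from laplacian_diff[OF this] show "laplacian (p - q) x = 0" for x
          by (simp add: q(2) fun_diff_def)
      qed
      from span_add[OF this q(1)] show ?thesis by simp
    qed
  qed
qed

section \<open>The moment functional\<close>

text \<open>
  The integral of \<open>t^b p(t)\<close> over \<open>[0,1]\<close> (see \<open>has_integral_moment\<close>), written through the coefficients
  so that integration by parts becomes an identity between coefficients.
\<close>

definition moment :: "real \<Rightarrow> real poly \<Rightarrow> real" where
  "moment b p = (\<Sum>i\<le>degree p. coeff p i / (real i + b + 1))"

lemma moment_eq_sum:
  assumes "degree p \<le> N" shows "moment b p = (\<Sum>i\<le>N. coeff p i / (real i + b + 1))"
  unfolding moment_def using assms
  by (intro sum.mono_neutral_left) (auto simp: coeff_eq_0)

lemma moment_0 [simp]: "moment b 0 = 0"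
  by (simp add: moment_def)

lemma moment_add: "moment b (p + q) = moment b p + moment b q"
proof -
  let ?N = "max (degree p) (degree q)"
  have "degree (p + q) \<le> ?N" by (rule degree_add_le_max)
  then show ?thesis
    by (simp add: moment_eq_sum[of _ ?N] sum.distrib[symmetric] add_divide_distrib)
qed

lemma moment_smult: "moment b (smult c p) = c * moment b p"
  by (simp add: moment_eq_sum[of "smult c p" "degree p"] moment_eq_sum[of p "degree p"]
      degree_smult_le sum_distrib_left)

lemma moment_diff: "moment b (p - q) = moment b p - moment b q"
  using moment_add[of b p "smult (-1) q"] by (simp add: moment_smult[of b "-1", simplified])

text \<open>
  The fundamental theorem of calculus for \<open>t^(b+1) p(t)\<close>, whose derivative is
  \<open>t^b ((b + 1) p + t p')\<close>; on coefficients the factor \<open>i + b + 1\<close> cancels the denominator.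
\<close>

lemma moment_euler:
  assumes "b > -1"
  shows "moment b (smult (b + 1) p + [:0, 1:] * pderiv p) = poly p 1"
proof -
  have c: "coeff (smult (b + 1) p + [:0, 1:] * pderiv p) i = (real i + b + 1) * coeff p i" for i
    by (cases i) (simp_all add: coeff_pderiv algebra_simps)
  have "degree (smult (b + 1) p + [:0, 1:] * pderiv p) \<le> degree p"
    by (rule degree_le) (simp only: c, simp add: coeff_eq_0)
  then have "moment b (smult (b + 1) p + [:0, 1:] * pderiv p) =
      (\<Sum>i\<le>degree p. (real i + b + 1) * coeff p i / (real i + b + 1))"
    by (simp only: moment_eq_sum c)
  also have "\<dots> = (\<Sum>i\<le>degree p. coeff p i)"
    using assms by (intro sum.cong) (auto simp: add_eq_0_iff)
  finally show ?thesis by (simp add: poly_altdef)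
qed

text \<open>
  Both sides equal \<open>-4\<close> times the moment of \<open>t g' q'\<close>: integrating by parts leaves the boundary terms
  \<open>g'(1) q(1)\<close> and \<open>g(1) q'(1)\<close>, which vanish by the double zero of \<open>g\<close>.
\<close>

lemma moment_radial_laplacian_sym:
  assumes b: "b > -1" and g: "poly g 1 = 0" "poly (pderiv g) 1 = 0"
  shows "moment b (radial_laplacian b g * q) = moment b (g * radial_laplacian b q)"
proof -
  let ?E = "\<lambda>p. smult (b + 1) p + [:0, 1:] * pderiv p"
  let ?D = "[:0, 1:] * (pderiv g * pderiv q)"
  have l: "radial_laplacian b g * q = smult 4 (?E (pderiv g * q) - ?D)"
    by (simp add: radial_laplacian_def pderiv_mult algebra_simps smult_add_right smult_diff_right)
  have r: "g * radial_laplacian b q = smult 4 (?E (g * pderiv q) - ?D)"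
    by (simp add: radial_laplacian_def pderiv_mult algebra_simps smult_add_right smult_diff_right)
  show ?thesis
    unfolding l r moment_smult moment_diff moment_euler[OF b] by (simp add: g)
qed

text \<open>
  Integrate the derivative of \<open>t^(b+1) f^2\<close>.  It involves \<open>t f'\<close>, which agrees with \<open>j f\<close> up to a
  remainder of degree less than \<open>j\<close>; orthogonality discards the remainder.  This computes the norm of an
  orthogonal polynomial from its value at \<open>1\<close>.
\<close>

lemma moment_square_orthogonal:
  assumes b: "b > -1" and deg: "degree f \<le> j"
    and orth: "\<And>q. degree q < j \<Longrightarrow> moment b (f * q) = 0"
  shows "(2 * real j + b + 1) * moment b (f * f) = (poly f 1)\<^sup>2"
proof -
  \<comment> \<open>the remainder \<open>t f' - j f\<close>; its coefficient of degree \<open>j\<close> cancels\<close>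
  define r where "r = [:0, 1:] * pderiv f - smult (real j) f"
  have c: "coeff r i = (real i - real j) * coeff f i" for i
    unfolding r_def by (cases i) (simp_all add: coeff_pderiv algebra_simps)
  have "degree r < j \<or> r = 0"
  proof (cases "j = 0")
    case True
    then have "coeff r i = 0" for i using deg by (cases "i = 0") (simp_all add: c coeff_eq_0)
    then show ?thesis by (simp add: poly_eq_iff)
  next
    case False
    have "coeff r i = 0" if "i > j - 1" for i
      using that deg by (cases "i = j") (auto simp: c coeff_eq_0)
    then have "degree r \<le> j - 1" by (intro degree_le) auto
    with False show ?thesis by linarith
  qed
  then have r: "moment b (f * r) = 0" using orth by auto
  have "smult (b + 1) (f * f) + [:0, 1:] * pderiv (f * f) =
      smult (2 * real j + b + 1) (f * f) + smult 2 (f * r)"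
    unfolding r_def poly_eq_poly_eq_iff[symmetric]
    by (simp add: fun_eq_iff pderiv_mult algebra_simps)
  from moment_euler[OF b, of "f * f", unfolded this] r show ?thesis
    by (simp add: moment_add moment_smult power2_eq_square)
qed

lemma has_integral_moment:
  assumes b: "b > -1"
  shows "((\<lambda>t. t powr b * poly p t) has_integral moment b p) {0..1}"
proof -
  have "((\<lambda>t. \<Sum>i\<le>degree p. coeff p i * t powr (real i + b)) has_integral
      (\<Sum>i\<le>degree p. coeff p i * (1 powr (real i + b + 1) / (real i + b + 1)))) {0..1}"
    using b by (intro has_integral_sum has_integral_mult_right has_integral_powr_from_0) auto
  then have "((\<lambda>t. \<Sum>i\<le>degree p. coeff p i * t powr (real i + b)) has_integral moment b p) {0..1}"
    by (simp add: moment_def)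
  then show ?thesis
  proof (rule has_integral_eq[rotated])
    fix t :: real assume "t \<in> {0..1}"
    then have "t powr (real i + b) = t powr b * t ^ i" for i
      by (cases "t = 0") (simp_all add: powr_add powr_realpow)
    then show "(\<Sum>i\<le>degree p. coeff p i * t powr (real i + b)) = t powr b * poly p t"
      by (simp add: poly_altdef sum_distrib_left algebra_simps)
  qed
qed

section \<open>Jacobi polynomials\<close>

definition jacobi_integral :: "real \<Rightarrow> real \<Rightarrow> real poly \<Rightarrow> real" where
  "jacobi_integral a b p = (LINT s:{-1..1}|lborel. (1 - s) powr a * (1 + s) powr b * poly p s)"

text \<open>
  The weight is integrable by the Beta integral, moved from \<open>[0,1]\<close> to \<open>[-1,1]\<close>; the polynomial factor is
  bounded.
\<close>

lemma jacobi_integrable: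
  fixes a b :: real
  assumes "a > -1" "b > -1"
  shows "set_integrable lborel {-1..1} (\<lambda>s. (1 - s) powr a * (1 + s) powr b * poly p s)"
proof -
  have "integrable lborel (\<lambda>t. indicator {0..1} t *\<^sub>R (t powr b * (1 - t) powr a))"
    using integrable_Beta[of "b + 1" "a + 1"] assms by (simp add: set_integrable_def)
  from lborel_integrable_real_affine[OF this, of "1/2" "1/2"]
  have "integrable lborel (\<lambda>s. indicator {0..1} (1/2 + 1/2 * s) *\<^sub>R
      ((1/2 + 1/2 * s) powr b * (1 - (1/2 + 1/2 * s)) powr a))" by simp
  moreover have "(\<lambda>s::real. indicator {0..1} (1/2 + 1/2 * s) *\<^sub>R
      ((1/2 + 1/2 * s) powr b * (1 - (1/2 + 1/2 * s)) powr a)) =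
      (\<lambda>s. (1 / (2 powr a * 2 powr b)) * (indicator {-1..1} s *\<^sub>R ((1 - s) powr a * (1 + s) powr b)))"
  proof
    fix s :: real
    define u v where "u = (1 + s) / 2" and "v = (1 - s) / 2"
    have h: "1/2 + 1/2 * s = u" "1 - u = v" by (simp_all add: u_def v_def field_simps)
    have "indicator {0..1} u = (indicator {-1..1} s :: real)"
      by (auto simp: indicator_def u_def)
    moreover have "u powr b * v powr a = 1 / (2 powr a * 2 powr b) * ((1 - s) powr a * (1 + s) powr b)"
      if "s \<in> {-1..1}"
      using that unfolding u_def v_def by (subst (1 2) powr_divide) (auto simp: mult_ac)
    ultimately show "indicator {0..1} (1/2 + 1/2 * s) *\<^sub>R
      ((1/2 + 1/2 * s) powr b * (1 - (1/2 + 1/2 * s)) powr a) =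
      (1 / (2 powr a * 2 powr b)) * (indicator {-1..1} s *\<^sub>R ((1 - s) powr a * (1 + s) powr b))"
      unfolding h by (cases "s \<in> {-1..1}") simp_all
  qed
  ultimately have w: "integrable lborel (\<lambda>s::real. indicator {-1..1} s *\<^sub>R ((1 - s) powr a * (1 + s) powr b))"
    by (simp only: integrable_mult_left_iff) simp
  have "bounded (poly p ` {-1..1})"
    by (intro compact_imp_bounded compact_continuous_image continuous_intros) auto
  then obtain C where C: "\<And>s. s \<in> {-1..1} \<Longrightarrow> \<bar>poly p s\<bar> \<le> C"
    unfolding bounded_iff by (metis image_eqI real_norm_def)
  show ?thesis
    unfolding set_integrable_def
  proof (rule Bochner_Integration.integrable_bound[OF integrable_mult_right[OF w, of C]])
    show "AE s in lborel. norm (indicator {-1..1} s *\<^sub>R ((1 - s) powr a * (1 + s) powr b * poly p s))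
        \<le> norm (C * (indicator {-1..1} s *\<^sub>R ((1 - s) powr a * (1 + s) powr b)))"
    proof (intro AE_I2)
      fix s :: real
      have "\<bar>(1 - s) powr a * (1 + s) powr b\<bar> * \<bar>poly p s\<bar> \<le> \<bar>(1 - s) powr a * (1 + s) powr b\<bar> * \<bar>C\<bar>"
        if "s \<in> {-1..1}" using C[OF that] by (intro mult_left_mono) auto
      then show "norm (indicator {-1..1} s *\<^sub>R ((1 - s) powr a * (1 + s) powr b * poly p s))
        \<le> norm (C * (indicator {-1..1} s *\<^sub>R ((1 - s) powr a * (1 + s) powr b)))"
        by (auto simp: indicator_def abs_mult mult_ac)
    qed
  next
    have [measurable]: "poly p \<in> borel_measurable borel"
      by (intro borel_measurable_continuous_onI continuous_intros)
    show "(\<lambda>s. indicator {-1..1} s *\<^sub>R ((1 - s) powr a * (1 + s) powr b * poly p s)) \<in> borel_measurable lborel"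
      by measurable
  qed
qed

lemma jacobi_integral_add:
  assumes "a > -1" "b > -1"
  shows "jacobi_integral a b (p + q) = jacobi_integral a b p + jacobi_integral a b q"
  unfolding jacobi_integral_def
  by (subst set_integral_add(2)[symmetric, OF jacobi_integrable[OF assms] jacobi_integrable[OF assms]])
     (simp add: distrib_left)

lemma jacobi_integral_smult: "jacobi_integral a b (smult c p) = c * jacobi_integral a b p"
  unfolding jacobi_integral_def
  by (simp add: mult.left_commute[of _ c] del: set_integral_mult_right) simp

text \<open>
  A vanishing integral would make \<open>r\<close> vanish almost everywhere on \<open>(-1,1)\<close>, but \<open>r\<close> has only finitely
  many roots.
\<close>

lemma jacobi_integral_square_pos:
  assumes ab: "a > -1" "b > -1" and r: "r \<noteq> 0"
  shows "jacobi_integral a b (r * r) > 0"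
proof -
  let ?F = "\<lambda>s. indicator {-1..1} s *\<^sub>R ((1 - s) powr a * (1 + s) powr b * poly (r * r) s)"
  have int: "integrable lborel ?F"
    using jacobi_integrable[OF ab, of "r * r"] by (simp only: set_integrable_def)
  have nn: "?F s \<ge> 0" for s by (simp add: indicator_def)
  have "jacobi_integral a b (r * r) \<noteq> 0"
  proof
    assume "jacobi_integral a b (r * r) = 0"
    then have "AE s in lborel. ?F s = 0"
      using integral_nonneg_eq_0_iff_AE[OF int] nn by (simp add: jacobi_integral_def set_lebesgue_integral_def)
    moreover have "AE s in lborel. s \<notin> {s. poly r s = 0}"
      using poly_roots_finite[OF r] by (intro AE_not_in finite_imp_null_set_lborel)
    ultimately have "AE s in lborel. s \<notin> {-1<..<1::real}"
      by eventually_elim (auto simp: indicator_def)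
    then have "emeasure lborel {-1<..<1::real} = 0"
      by (subst (asm) AE_iff_measurable[of "{-1<..<1}"]) auto
    then show False by simp
  qed
  moreover have "jacobi_integral a b (r * r) \<ge> 0"
    unfolding jacobi_integral_def set_lebesgue_integral_def using nn by (rule Bochner_Integration.integral_nonneg)
  ultimately show ?thesis by simp
qed

text \<open>
  Gram-Schmidt, organised as the existence of orthogonal projections \<open>q\<close> onto the polynomials of degree
  less than \<open>j\<close>.  Since \<open>degree 0 = 0\<close>, the case \<open>j = 0\<close> forces the alternative \<open>q = 0\<close>.
\<close>

lemma exists_orthogonal_polynomial:
  fixes I :: "real poly \<Rightarrow> real"
  assumes add: "\<And>p q. I (p + q) = I p + I q" and smult: "\<And>c p. I (smult c p) = c * I p"
    and pos: "\<And>r. r \<noteq> 0 \<Longrightarrow> I (r * r) > 0"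
  shows "\<exists>p. p \<noteq> 0 \<and> degree p = j \<and> (\<forall>q. degree q < j \<longrightarrow> I (p * q) = 0)"
proof -
  have diff: "I (p - q) = I p - I q" for p q
    using add[of p "smult (-1) q"] smult[of "-1" q] by simp
  have proj: "\<exists>q. (q = 0 \<or> degree q < j) \<and> (\<forall>r. degree r < j \<longrightarrow> I ((f - q) * r) = 0)" for f j
  proof (induction j arbitrary: f)
    case 0
    show ?case by auto
  next
    case (Suc j)
    obtain h where h: "h = 0 \<or> degree h < j" "\<And>r. degree r < j \<Longrightarrow> I ((monom 1 j - h) * r) = 0"
      using Suc by blast
    \<comment> \<open>the orthogonal polynomial of degree \<open>j\<close>, the new direction to project on\<close>
    define e where "e = monom 1 j - h"
    have ce: "coeff e j = 1" using h(1) by (auto simp: e_def coeff_eq_0)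
    have de: "degree e \<le> j"
      using h(1) by (auto simp: e_def degree_monom_eq intro!: degree_diff_le)
    have e0: "e \<noteq> 0" using ce by auto
    obtain u where u: "u = 0 \<or> degree u < j" "\<And>r. degree r < j \<Longrightarrow> I ((f - u) * r) = 0"
      using Suc by blast
    define c where "c = I ((f - u) * e) / I (e * e)"
    show ?case
    proof (intro exI conjI allI impI)
      show "u + smult c e = 0 \<or> degree (u + smult c e) < Suc j"
        using u(1) de degree_smult_le[of c e]
        by (auto simp: less_Suc_eq_le intro!: degree_add_le)
    next
      fix r :: "real poly" assume r: "degree r < Suc j"
      define r' where "r' = r - smult (coeff r j) e"
      have "coeff r' i = 0" if "i \<ge> j" for i
        using that r de ce by (cases "i = j") (auto simp: r'_def coeff_eq_0)
      then have r': "r' = 0 \<or> degree r' < j"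
        using leading_coeff_0_iff not_le by blast
      have "I ((f - u - smult c e) * r') = I ((f - u) * r') - c * I (e * r')"
        by (simp add: diff smult left_diff_distrib[of "f - u"])
      also have "\<dots> = 0"
        using r' u(2)[of r'] h(2)[of r'] smult[of 0 0] by (auto simp: e_def)
      finally have 1: "I ((f - u - smult c e) * r') = 0" .
      have 2: "I ((f - u - smult c e) * e) = 0"
        using pos[OF e0] by (simp add: diff smult left_diff_distrib[of "f - u"] c_def)
      have "(f - (u + smult c e)) * r = (f - u - smult c e) * r' + smult (coeff r j) ((f - u - smult c e) * e)"
        by (simp add: r'_def algebra_simps smult_diff_right smult_add_right)
      then show "I ((f - (u + smult c e)) * r) = 0" by (simp only: add smult 1 2)
    qed
  qed
  obtain h where h: "h = 0 \<or> degree h < j" "\<And>r. degree r < j \<Longrightarrow> I ((monom 1 j - h) * r) = 0"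
    using proj by blast
  have "coeff (monom 1 j - h) j = 1" using h(1) by (auto simp: coeff_eq_0)
  moreover have "degree (monom 1 j - h) \<le> j"
    using h(1) by (auto simp: degree_monom_eq intro!: degree_diff_le)
  ultimately have "monom 1 j - h \<noteq> 0 \<and> degree (monom 1 j - h) = j"
    using le_degree[of "monom 1 j - h" j] by auto
  then show ?thesis using h(2) by blast
qed

lemma gbinomial_jacobi_nonzero:
  assumes "a > (-1::real)" shows "(real j + a) gchoose j \<noteq> 0"
proof -
  have "real j + a - real i \<noteq> 0" if "i < j" for i
    using that assms by linarith
  then show ?thesis by (auto simp: gbinomial_prod_rev)
qed

text \<open>
  An orthogonal polynomial \<open>p\<close> of degree \<open>j\<close> is unique up to a factor, because a suitable combination of
  two of them has smaller degree and is orthogonal to itself.  The normalisation at \<open>1\<close> then picks exactly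
  one, provided that \<open>p(1) \<noteq> 0\<close>: otherwise \<open>p = (s - 1) r\<close>, and the integral of \<open>w p r\<close>, which is zero by
  orthogonality, would be the negative of the integral of \<open>r^2\<close> against the weight with \<open>a + 1\<close> in place
  of \<open>a\<close>.
\<close>

lemma jacobi_poly_exists1:
  assumes ab: "a > -1" "b > -1"
  shows "\<exists>!p. degree p = j \<and> (\<forall>q. degree q < j \<longrightarrow> jacobi_integral a b (p * q) = 0) \<and>
    poly p 1 = (real j + a) gchoose j"
proof -
  let ?I = "jacobi_integral a b" and ?c = "(real j + a) gchoose j"
  note I = jacobi_integral_add[OF ab] jacobi_integral_smult jacobi_integral_square_pos[OF ab]
  obtain p where p: "p \<noteq> 0" "degree p = j" "\<And>q. degree q < j \<Longrightarrow> ?I (p * q) = 0"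
    using exists_orthogonal_polynomial[where I = ?I and j = j, OF I] by blast
  have p1: "poly p 1 \<noteq> 0"
  proof
    assume "poly p 1 = 0"
    then obtain r where r: "p = [:-1, 1:] * r" by (auto simp: poly_eq_0_iff_dvd)
    then have "r \<noteq> 0" using p(1) by auto
    then have "degree r < j" using p(2) r by (simp add: degree_mult_eq del: mult_pCons_left)
    then have "0 = ?I (p * r)" using p(3) by simp
    also have "p * r = smult (-1) ([:1, -1:] * (r * r))"
      unfolding r by (subst poly_eq_poly_eq_iff[symmetric]) (simp add: fun_eq_iff algebra_simps)
    also have "?I (smult (-1) ([:1, -1:] * (r * r))) = - ?I ([:1, -1:] * (r * r))"
      by (simp only: jacobi_integral_smult)
    also have "?I ([:1, -1:] * (r * r)) = jacobi_integral (a + 1) b (r * r)"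
      unfolding jacobi_integral_def
    proof (rule set_lebesgue_integral_cong)
      show "\<forall>s. s \<in> {-1..1} \<longrightarrow> (1 - s) powr a * (1 + s) powr b * poly ([:1, - 1:] * (r * r)) s =
        (1 - s) powr (a + 1) * (1 + s) powr b * poly (r * r) s"
      proof (intro allI impI)
        fix s :: real assume "s \<in> {-1..1}"
        then have *: "(1 - s) powr (a + 1) = (1 - s) powr a * (1 - s)"
          by (cases "s = 1") (simp_all add: powr_add)
        show "(1 - s) powr a * (1 + s) powr b * poly ([:1, - 1:] * (r * r)) s =
            (1 - s) powr (a + 1) * (1 + s) powr b * poly (r * r) s"
          unfolding * by (simp add: algebra_simps)
      qed
    qed simp
    finally have "jacobi_integral (a + 1) b (r * r) = 0" by simp
    with jacobi_integral_square_pos[of "a + 1" b r] ab \<open>r \<noteq> 0\<close> show False by simp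
  qed
  have uniq: "p' = smult (coeff p' j / coeff p j) p"
    if p': "degree p' = j" "\<And>q. degree q < j \<Longrightarrow> ?I (p' * q) = 0" for p'
  proof (rule ccontr)
    assume *: "p' \<noteq> smult (coeff p' j / coeff p j) p"
    define e where "e = p' - smult (coeff p' j / coeff p j) p"
    have "coeff p j \<noteq> 0" using p by (metis leading_coeff_0_iff)
    then have "coeff e i = 0" if "i \<ge> j" for i
      using that p(2) p'(1) by (cases "i = j") (auto simp: e_def coeff_eq_0)
    moreover have e0: "e \<noteq> 0" using * by (simp add: e_def)
    ultimately have "degree e < j" by (meson leading_coeff_0_iff not_le)
    moreover have "e * e = p' * e + smult (- (coeff p' j / coeff p j)) (p * e)"
    proof -
      have "e * e = (p' - smult (coeff p' j / coeff p j) p) * e" by (simp only: e_def)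
      then show ?thesis by (simp add: left_diff_distrib)
    qed
    ultimately have "?I (e * e) = 0"
      using p(3) p'(2) by (simp only: I(1,2))
    then show False using I(3)[OF e0] by simp
  qed
  show ?thesis
  proof (rule ex1I[of _ "smult (?c / poly p 1) p"])
    have "?c / poly p 1 \<noteq> 0" using gbinomial_jacobi_nonzero[OF ab(1)] p1 by simp
    then show "degree (smult (?c / poly p 1) p) = j \<and>
       (\<forall>q. degree q < j \<longrightarrow> ?I (smult (?c / poly p 1) p * q) = 0) \<and>
       poly (smult (?c / poly p 1) p) 1 = ?c"
      using p p1 by (simp add: I(2))
  next
    fix p' assume p': "degree p' = j \<and> (\<forall>q. degree q < j \<longrightarrow> ?I (p' * q) = 0) \<and> poly p' 1 = ?c"
    then have eq: "p' = smult (coeff p' j / coeff p j) p" using uniq by blast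
    then have "?c = coeff p' j / coeff p j * poly p 1" using p' by (metis poly_smult)
    then have "?c / poly p 1 = coeff p' j / coeff p j" using p1 by simp
    with eq show "p' = smult (?c / poly p 1) p" by simp
  qed
qed

lemma jacobi_poly_properties:
  assumes "a > -1" "b > -1"
  shows "degree (jacobi_poly a b j) = j"
    and "degree q < j \<Longrightarrow> jacobi_integral a b (jacobi_poly a b j * q) = 0"
    and "poly (jacobi_poly a b j) 1 = (real j + a) gchoose j"
proof -
  have "jacobi_poly a b j = (THE p. degree p = j \<and>
      (\<forall>q. degree q < j \<longrightarrow> jacobi_integral a b (p * q) = 0) \<and> poly p 1 = (real j + a) gchoose j)"
    by (simp add: jacobi_poly_def jacobi_integral_def mult.assoc)
  with theI'[OF jacobi_poly_exists1[OF assms, of j]]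
  have *: "degree (jacobi_poly a b j) = j \<and>
      (\<forall>q. degree q < j \<longrightarrow> jacobi_integral a b (jacobi_poly a b j * q) = 0) \<and>
      poly (jacobi_poly a b j) 1 = (real j + a) gchoose j" by simp
  show "degree (jacobi_poly a b j) = j" using * by blast
  show "degree q < j \<Longrightarrow> jacobi_integral a b (jacobi_poly a b j * q) = 0" using * by blast
  show "poly (jacobi_poly a b j) 1 = (real j + a) gchoose j" using * by blast
qed

text \<open>
  The substitution \<open>s = 2t - 1\<close>: the weight becomes \<open>2^(b+2) (1 - t)^2 t^b\<close> and \<open>ds = 2 dt\<close>.  For \<open>a = 2\<close>
  the first factor of the weight is a polynomial, so moments for \<open>t^b\<close> suffice.
\<close>

lemma jacobi_integral_2_eq_moment:
  assumes b: "b > -1"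
  shows "jacobi_integral 2 b p = 2 powr (b + 3) * moment b ([:1, -1:]\<^sup>2 * pcompose p [:-1, 2:])"
proof -
  let ?F = "\<lambda>s. indicator {-1..1} s *\<^sub>R ((1 - s) powr 2 * (1 + s) powr b * poly p s)"
  let ?q = "[:1, -1:]\<^sup>2 * pcompose p [:-1, 2:]"
  let ?G = "\<lambda>t. indicator {0..1} t *\<^sub>R (t powr b * poly ?q t)"
  have eq: "?F (-1 + 2 * t) = 2 powr (b + 2) * ?G t" for t
  proof (cases "t \<in> {0..1}")
    case True
    have "(1 - (-1 + 2 * t)) powr 2 = 2\<^sup>2 * (1 - t)\<^sup>2"
      using True by (simp add: powr_numeral power2_eq_square algebra_simps)
    moreover have "(1 + (-1 + 2 * t)) powr b = 2 powr b * t powr b"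
      using True by (simp add: powr_mult)
    ultimately show ?thesis
      using True by (simp add: poly_pcompose powr_add powr_numeral algebra_simps)
  qed (auto simp: indicator_def)
  have "integrable lborel ?F"
    using jacobi_integrable[of 2 b p] b by (simp add: set_integrable_def)
  from lborel_integrable_real_affine[OF this, of 2 "-1"]
  have "integrable lborel (\<lambda>t. 2 powr (b + 2) * ?G t)" unfolding eq by simp
  then have "set_integrable lborel {0..1} (\<lambda>t. t powr b * poly ?q t)"
    unfolding set_integrable_def by (simp only: integrable_mult_left_iff) simp
  from set_borel_integral_eq_integral(2)[OF this] has_integral_moment[OF b, of ?q]
  have G: "(LINT t|lborel. ?G t) = moment b ?q"
    by (simp add: set_lebesgue_integral_def integral_unique)
  have "jacobi_integral 2 b p = 2 * (LINT t|lborel. ?F (-1 + 2 * t))"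
    unfolding jacobi_integral_def set_lebesgue_integral_def
    by (subst lborel_integral_real_affine[where c = 2 and t = "-1"]) auto
  also have "\<dots> = 2 * (2 powr (b + 2) * moment b ?q)"
    unfolding eq by (simp only: integral_mult_right_zero G)
  also have "\<dots> = 2 powr (b + 3) * moment b ?q"
    by (simp add: powr_add powr_numeral)
  finally show ?thesis .
qed

section \<open>The radial factors\<close>

text \<open>
  The radial part of the basis polynomial with index \<open>j\<close>, as a polynomial in \<open>t = |x|^2\<close>.
\<close>

definition radial_factor :: "real \<Rightarrow> nat \<Rightarrow> real poly" where
  "radial_factor b j =
     (if j = 0 then 1 else [:1, -1:] * pcompose (jacobi_poly 2 b (j - 1)) [:-1, 2:])"

text \<open>
  The radial part of \<open>\<Delta>[(1 - |x|^2) Q]\<close>, called \<open>f_j\<close> in the introduction.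
\<close>

definition radial_image :: "real \<Rightarrow> nat \<Rightarrow> real poly" where
  "radial_image b j = radial_laplacian b ([:1, -1:] * radial_factor b j)"

lemma weighted_radial_factor:
  "[:1, -1:] * radial_factor b (Suc i) = [:1, -1:]\<^sup>2 * pcompose (jacobi_poly 2 b i) [:-1, 2:]"
  by (simp only: radial_factor_def diff_Suc_1 nat.distinct if_False power2_eq_square mult.assoc)

lemma degree_radial_laplacian: "degree (radial_laplacian b g) \<le> degree g - 1"
proof -
  have "coeff (radial_laplacian b g) i = 0" if "i > degree g - 1" for i
    using that by (cases i) (auto simp: radial_laplacian_def coeff_pderiv coeff_eq_0)
  then show ?thesis by (intro degree_le) auto
qed

lemma degree_radial_factor:
  assumes "b > -1" shows "degree (radial_factor b j) = j" "radial_factor b j \<noteq> 0"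
proof -
  have 1: "radial_factor b j \<noteq> 0 \<and> degree (radial_factor b j) = j"
  proof (cases j)
    case (Suc i)
    let ?P = "pcompose (jacobi_poly 2 b i) [:-1, 2:]"
    have "poly (jacobi_poly 2 b i) 1 \<noteq> 0"
      using jacobi_poly_properties(3)[of 2 b i] assms gbinomial_jacobi_nonzero[of 2 i] by simp
    then have "poly ?P 1 \<noteq> 0" by (simp add: poly_pcompose)
    then have "?P \<noteq> 0" by auto
    moreover have "degree ?P = i"
      using jacobi_poly_properties(1)[of 2 b i] assms by (simp add: degree_pcompose)
    ultimately show ?thesis
      using Suc by (simp add: radial_factor_def degree_mult_eq del: mult_pCons_left)
  qed (simp add: radial_factor_def)
  then show "degree (radial_factor b j) = j" "radial_factor b j \<noteq> 0" by blast+
qed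

lemma degree_radial_image:
  assumes "b > -1" shows "degree (radial_image b j) \<le> j"
proof -
  have "degree ([:1, -1:] * radial_factor b j) = Suc j"
    using degree_radial_factor[OF assms, of j] by (simp add: degree_mult_eq del: mult_pCons_left)
  then show ?thesis
    unfolding radial_image_def using degree_radial_laplacian[of b "[:1, -1:] * radial_factor b j"] by simp
qed

text \<open>
  Moving \<open>L\<close> from \<open>g = (1 - t)^2 P(2t - 1)\<close> to \<open>q\<close> leaves the moment of \<open>(1 - t)^2 P(2t - 1) L q\<close>, and
  \<open>L q\<close> has degree less than \<open>j - 1\<close>, the degree of \<open>P\<close>.  For \<open>j = 1\<close> there is no smaller degree, but
  then \<open>q\<close> is constant and \<open>L q = 0\<close>.
\<close>

lemma radial_image_orthogonal:
  assumes b: "b > -1" and q: "degree q < j"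
  shows "moment b (radial_image b j * q) = 0"
proof -
  from q obtain i where j: "j = Suc i" by (cases j) auto
  let ?J = "jacobi_poly 2 b i" and ?P = "pcompose (jacobi_poly 2 b i) [:-1, 2:]"
  let ?g = "[:1, -1:]\<^sup>2 * ?P" and ?r = "radial_laplacian b q"
  have img: "radial_image b j = radial_laplacian b ?g"
    unfolding radial_image_def j weighted_radial_factor ..
  have "moment b (radial_laplacian b ?g * q) = moment b (?g * ?r)"
    by (rule moment_radial_laplacian_sym[OF b])
       (simp_all add: pderiv_mult pderiv_power_Suc power2_eq_square pderiv_pCons del: mult_pCons_left)
  also have "\<dots> = 0"
  proof (cases "i = 0")
    case True
    then have "degree q = 0" using q j by simp
    then have "?r = 0" by (auto simp: radial_laplacian_def elim: degree_eq_zeroE)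
    then show ?thesis by simp
  next
    case False
    \<comment> \<open>\<open>L q\<close> in the variable \<open>s = 2t - 1\<close>\<close>
    define u where "u = pcompose ?r [:1/2, 1/2:]"
    have "pcompose u [:-1, 2:] = ?r"
      by (simp add: u_def pcompose_assoc[symmetric] pcompose_pCons)
    then have g: "[:1, -1:]\<^sup>2 * pcompose (?J * u) [:-1, 2:] = ?g * ?r"
      by (simp add: pcompose_mult mult.assoc)
    have "degree u = degree ?r" by (simp add: u_def degree_pcompose)
    then have "degree u < i" using degree_radial_laplacian[of b q] q j False by simp
    then have "jacobi_integral 2 b (?J * u) = 0" using jacobi_poly_properties(2)[of 2 b] b by simp
    then show ?thesis using jacobi_integral_2_eq_moment[OF b, of "?J * u"] unfolding g by simp
  qed
  finally show ?thesis unfolding img .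
qed

text \<open>
  At \<open>t = 1\<close> only the second derivative of the double zero survives: \<open>(L g)(1) = 4 g''(1) = 8 P(1)\<close>, and
  the normalisation is \<open>P(1) = (j + 1) choose 2\<close>.
\<close>

lemma poly_radial_image_1:
  assumes b: "b > -1" and "j > 0"
  shows "poly (radial_image b j) 1 = 4 * real j * (real j + 1)"
proof -
  from assms obtain i where j: "j = Suc i" by (cases j) auto
  let ?P = "pcompose (jacobi_poly 2 b i) [:-1, 2:]"
  have img: "radial_image b j = radial_laplacian b ([:1, -1:]\<^sup>2 * ?P)"
    unfolding radial_image_def j weighted_radial_factor ..
  have "poly (radial_image b j) 1 = 8 * poly ?P 1"
    unfolding img
    by (simp add: radial_laplacian_def pderiv_mult power2_eq_square pderiv_pCons pderiv_add algebra_simps del: mult_pCons_left)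
  also have "poly ?P 1 = (real i + 2) gchoose i"
    using jacobi_poly_properties(3)[of 2 b i] b by (simp add: poly_pcompose)
  also have "\<dots> = real ((i + 2) choose i)"
    by (simp add: binomial_gbinomial add.commute)
  also have "(i + 2) choose i = (i + 2) choose 2"
    using binomial_symmetric[of 2 "i + 2"] by simp
  also have "8 * real ((i + 2) choose 2) = 4 * real (2 * ((i + 2) choose 2))" by simp
  also have "2 * ((i + 2) choose 2) = (i + 2) * (i + 1)"
    by (simp add: choose_two)
  finally show ?thesis by (simp add: j algebra_simps)
qed

lemma moment_radial_image_square:
  assumes b: "b > -1"
  shows "moment b (radial_image b j * radial_image b j) =
    (if j = 0 then 16 * (b + 1) else 16 * (real j)\<^sup>2 * (real j + 1)\<^sup>2 / (2 * real j + b + 1))"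
proof -
  have "(2 * real j + b + 1) * moment b (radial_image b j * radial_image b j) = (poly (radial_image b j) 1)\<^sup>2"
    by (intro moment_square_orthogonal b degree_radial_image radial_image_orthogonal)
  moreover have "2 * real j + b + 1 > 0" using b by (simp add: add_nonneg_pos)
  ultimately have *: "moment b (radial_image b j * radial_image b j) =
      (poly (radial_image b j) 1)\<^sup>2 / (2 * real j + b + 1)"
    by (simp add: field_simps)
  show ?thesis
  proof (cases "j = 0")
    case True
    have "poly (radial_image b 0) 1 = - 4 * (b + 1)"
      by (simp add: radial_image_def radial_factor_def radial_laplacian_def pderiv_pCons)
    moreover have "(- 4 * (b + 1))\<^sup>2 / (b + 1) = 16 * (b + 1)"
      using b by (simp add: power2_eq_square field_simps)
    ultimately show ?thesis using True unfolding * by simp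
  next
    case False
    then show ?thesis
      unfolding * using poly_radial_image_1[OF b, of j] by (simp add: power_mult_distrib)
  qed
qed

lemma moment_radial_image_orthogonal:
  assumes b: "b > -1" and "i \<noteq> j"
  shows "moment b (radial_image b i * radial_image b j) = 0"
proof (cases "i < j")
  case True
  then show ?thesis
    using radial_image_orthogonal[OF b, of "radial_image b i" j] degree_radial_image[OF b, of i]
    by (simp add: mult.commute)
next
  case False
  then show ?thesis
    using radial_image_orthogonal[OF b, of "radial_image b j" i] degree_radial_image[OF b, of j] assms(2)
    by simp
qed

section \<open>Integration by parts on the ball\<close>

lemma polyfun_integrable_cball:
  "f \<in> polyfuns \<Longrightarrow> set_integrable lborel (cball 0 r) f"
  unfolding set_integrable_def
  by (intro borel_integrable_compact compact_cball continuous_on_subset[OF polyfun_continuous]) auto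

lemma polyfun_bounded_cball:
  assumes "f \<in> polyfuns"
  obtains C where "C \<ge> 0" "\<And>x. x \<in> cball 0 r \<Longrightarrow> \<bar>f x\<bar> \<le> C"
proof -
  have "bounded (f ` cball 0 r)"
    using assms by (intro compact_imp_bounded compact_continuous_image compact_cball
        continuous_on_subset[OF polyfun_continuous]) auto
  then obtain C where "\<And>x. x \<in> cball 0 r \<Longrightarrow> \<bar>f x\<bar> \<le> C" unfolding bounded_iff by (metis image_eqI real_norm_def)
  then show ?thesis by (intro that[of "max C 0"]) (auto simp: le_max_iff_disj)
qed

lemma polyfun_borel: "f \<in> polyfuns \<Longrightarrow> f \<in> borel_measurable borel"
  by (intro borel_measurable_continuous_onI polyfun_continuous)

lemma AE_norm_ne_1: "AE x in lborel. norm (x :: real^'d::finite) \<noteq> 1"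
proof -
  have "negligible (sphere (0::real^'d) 1)"
    using negligible_convex_frontier[of "cball (0::real^'d) 1"] by simp
  then have "sphere (0::real^'d) 1 \<in> null_sets lborel"
    by (simp add: negligible_iff_null_sets null_sets_completion_iff)
  from AE_not_in[OF this] show ?thesis by eventually_elim simp
qed

text \<open>
  The divergence theorem for a field that vanishes on the sphere, proved by translation invariance.  Extend
  \<open>(1 - |y|^2) f\<close> by zero outside the ball to a function \<open>u\<close>.  Its difference quotients in the direction
  of a coordinate axis have integral zero, are uniformly bounded because \<open>u\<close> is Lipschitz, and converge to
  the partial derivative off the sphere, which is a null set; dominated convergence concludes.
\<close>

lemma integral_ball_partial_deriv:
  fixes f :: "real^'d::finite \<Rightarrow> real"
  assumes f: "f \<in> polyfuns"
  shows "(LINT x:cball 0 1|lborel. partial_deriv i (\<lambda>y. (1 - (norm y)\<^sup>2) * f y) x) = 0"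
proof -
  let ?e = "axis i 1 :: real^'d"
  define F where "F = (\<lambda>y. (1 - (norm y)\<^sup>2) * f y)"
  have F: "F \<in> polyfuns" unfolding F_def by (intro polyfuns_intros f)
  define w where "w x = max 0 (1 - (norm x)\<^sup>2)" for x :: "real^'d"
  define u where "u x = w x * f x" for x
  have u_in: "u x = F x" if "norm x \<le> 1" for x
    using that power_le_one[of "norm x" 2] by (simp add: u_def w_def F_def)
  have u_out: "u x = 0" if "norm x \<ge> 1" for x
    using that one_le_power[of "norm x" 2] by (simp add: u_def w_def)
  have u_ind: "u = (\<lambda>x. indicator (cball 0 1) x *\<^sub>R F x)"
    using u_in u_out by (force simp: fun_eq_iff indicator_def)
  have u_int: "integrable lborel u"
    using polyfun_integrable_cball[OF F, of 1] by (simp add: u_ind set_integrable_def)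
  define t where "t n = 1 / (real n + 1)" for n
  have t: "0 < t n" "t n \<le> 1" for n by (simp_all add: t_def)
  define D where "D n x = (u (x + t n *\<^sub>R ?e) - u x) / t n" for n x
  have shift: "integrable lborel (\<lambda>x. u (x + c))" "(LINT x|lborel. u (x + c)) = (LINT x|lborel. u x)" for c
  proof -
    have L: "lborel = distr lborel borel ((+) c)" using lborel_distr_plus[of c] by simp
    have "integrable (distr lborel borel ((+) c)) u" using u_int L by simp
    then show "integrable lborel (\<lambda>x. u (x + c))"
      by (subst (asm) integrable_distr_eq) (use u_int in \<open>auto simp: add.commute\<close>)
    have "(LINT x|lborel. u x) = (LINT x|distr lborel borel ((+) c). u x)" using L by simp
    also have "\<dots> = (LINT x|lborel. u (c + x))"
      by (rule integral_distr) (use u_int in auto)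
    finally show "(LINT x|lborel. u (x + c)) = (LINT x|lborel. u x)" by (simp add: add.commute)
  qed
  have D0: "(LINT x|lborel. D n x) = 0" for n
    unfolding D_def by (simp add: shift u_int)
  obtain K1 where K1: "K1 \<ge> 0" "\<And>x. x \<in> cball 0 3 \<Longrightarrow> \<bar>f x\<bar> \<le> K1"
    using polyfun_bounded_cball[OF f] by blast
  obtain K2 where K2: "K2 \<ge> 0" "\<And>x. x \<in> cball 0 3 \<Longrightarrow> \<bar>partial_deriv i f x\<bar> \<le> K2"
    using polyfun_bounded_cball[OF polyfuns_partial_deriv[OF f]] by blast
  have shift_norm: "norm (x + s *\<^sub>R ?e) \<le> norm x + \<bar>s\<bar>" for x s
    using norm_triangle_ineq[of x "s *\<^sub>R ?e"] by simp
  have bound: "norm (D n x) \<le> indicator (cball 0 2) x *\<^sub>R (5 * K1 + K2)" for n x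
  proof (cases "x \<in> cball 0 2")
    case True
    let ?y = "x + t n *\<^sub>R ?e"
    have y3: "x + s *\<^sub>R ?e \<in> cball 0 3" if "0 \<le> s" "s \<le> t n" for s
      using shift_norm[of x s] True that t[of n] by simp
    have "\<exists>z. z > 0 \<and> z < t n \<and> f (x + t n *\<^sub>R ?e) - f (x + 0 *\<^sub>R ?e) =
        (t n - 0) * partial_deriv i f (x + z *\<^sub>R ?e)"
      by (rule MVT2) (use t polyfun_has_partial_deriv_at[OF f] in auto)
    then obtain z where z: "0 < z" "z < t n" "f ?y - f x = t n * partial_deriv i f (x + z *\<^sub>R ?e)"
      by auto
    \<comment> \<open>mean value theorem along the segment, which stays in the ball of radius \<open>3\<close>\<close>
    have f_diff: "\<bar>f ?y - f x\<bar> \<le> t n * K2"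
      unfolding z(3) abs_mult using t[of n] K2(2)[OF y3, of z] z by simp
    have nsq: "(norm ?y)\<^sup>2 = (norm x)\<^sup>2 + (2 * x $ i + t n) * t n"
      unfolding power2_norm_eq_inner
      by (simp add: inner_add_left inner_add_right inner_axis' inner_axis
          algebra_simps power2_eq_square inner_axis_axis del: power2_norm_eq_inner)
    have "\<bar>w ?y - w x\<bar> \<le> \<bar>(norm ?y)\<^sup>2 - (norm x)\<^sup>2\<bar>"
      unfolding w_def by linarith
    also have "\<dots> = \<bar>2 * x $ i + t n\<bar> * t n"
      using t[of n] by (simp add: nsq abs_mult)
    also have "\<dots> \<le> 5 * t n"
    proof (intro mult_right_mono)
      have "\<bar>x $ i\<bar> \<le> 2" using component_le_norm_cart[of x i] True by simp
      then show "\<bar>2 * x $ i + t n\<bar> \<le> 5" using t[of n] by linarith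
    qed (use t[of n] in simp)
    finally have w_diff: "\<bar>w ?y - w x\<bar> \<le> 5 * t n" .
    have "u ?y - u x = (w ?y - w x) * f ?y + w x * (f ?y - f x)"
      by (simp add: u_def algebra_simps)
    then have "\<bar>u ?y - u x\<bar> \<le> \<bar>w ?y - w x\<bar> * \<bar>f ?y\<bar> + \<bar>w x\<bar> * \<bar>f ?y - f x\<bar>"
      by (metis abs_mult abs_triangle_ineq)
    also have "\<dots> \<le> (5 * t n) * K1 + 1 * (t n * K2)"
      using w_diff f_diff K1 y3[of "t n"] t[of n] by (intro add_mono mult_mono) (auto simp: w_def)
    also have "\<dots> = (5 * K1 + K2) * t n" by (simp add: algebra_simps)
    finally have "\<bar>u ?y - u x\<bar> / t n \<le> 5 * K1 + K2"
      using t[of n] by (simp add: pos_divide_le_eq)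
    then show ?thesis using True t[of n] by (simp add: D_def)
  next
    case False
    \<comment> \<open>both end points lie outside the unit ball, since the shift is at most \<open>1\<close>\<close>
    have "norm x - t n \<le> norm (x + t n *\<^sub>R ?e)"
      using norm_diff_ineq[of x "t n *\<^sub>R ?e"] t[of n] by simp
    then have "norm (x + t n *\<^sub>R ?e) \<ge> 1" "norm x \<ge> 1" using False t[of n] by auto
    then show ?thesis using False by (simp add: D_def u_out)
  qed
  have t_lim: "t \<longlonglongrightarrow> 0"
    unfolding t_def using LIMSEQ_inverse_real_of_nat by (simp add: inverse_eq_divide add.commute)
  have y_lim: "(\<lambda>n. norm (x + t n *\<^sub>R ?e)) \<longlonglongrightarrow> norm x" for x
    using tendsto_norm[OF tendsto_add[OF tendsto_const[of x] tendsto_scaleR[OF t_lim tendsto_const[of ?e]]]]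
    by simp
  have lim: "(\<lambda>n. D n x) \<longlonglongrightarrow> indicator (cball 0 1) x *\<^sub>R partial_deriv i F x" if "norm x \<noteq> 1" for x
  proof (cases "norm x < 1")
    case True
    have "((\<lambda>h. (F (x + h *\<^sub>R ?e) - F x) / h) \<longlongrightarrow> partial_deriv i F x) (at 0)"
      using polyfun_has_partial_deriv[OF F, of x i] by (simp add: DERIV_def)
    moreover have "filterlim t (at 0) sequentially"
      using t_lim t(1) by (auto simp: filterlim_at intro!: always_eventually) (metis less_irrefl)
    ultimately have "(\<lambda>n. (F (x + t n *\<^sub>R ?e) - F x) / t n) \<longlonglongrightarrow> partial_deriv i F x"
      by (rule filterlim_compose)
    moreover have "eventually (\<lambda>n. (F (x + t n *\<^sub>R ?e) - F x) / t n = D n x) sequentially"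
      using order_tendstoD(2)[OF y_lim True] by eventually_elim (use True in \<open>simp add: D_def u_in\<close>)
    ultimately show ?thesis
      using True by (simp add: tendsto_cong)
  next
    case False
    with that have gt: "norm x > 1" by simp
    have "eventually (\<lambda>n. D n x = 0) sequentially"
      using order_tendstoD(1)[OF y_lim gt] by eventually_elim (use gt in \<open>simp add: D_def u_out\<close>)
    then show ?thesis using gt by (simp add: tendsto_eventually)
  qed
  have "(\<lambda>n. LINT x|lborel. D n x) \<longlonglongrightarrow> (LINT x|lborel. indicator (cball 0 1) x *\<^sub>R partial_deriv i F x)"
  proof (rule integral_dominated_convergence[where w = "\<lambda>x. indicator (cball 0 2) x *\<^sub>R (5 * K1 + K2)"])
    show "(\<lambda>x. indicator (cball 0 1) x *\<^sub>R partial_deriv i F x) \<in> borel_measurable lborel"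
      using polyfun_borel[OF polyfuns_partial_deriv[OF F], of i]
      by (intro borel_measurable_scaleR borel_measurable_indicator) auto
    show "D n \<in> borel_measurable lborel" for n
      unfolding D_def
      using borel_measurable_integrable[OF shift(1), of "t n *\<^sub>R ?e"] borel_measurable_integrable[OF u_int]
      by measurable
    show "integrable lborel (\<lambda>x::real^'d. indicator (cball 0 2) x *\<^sub>R (5 * K1 + K2))"
      by (intro borel_integrable_compact compact_cball continuous_on_const)
    show "AE x in lborel. (\<lambda>n. D n x) \<longlonglongrightarrow> indicator (cball 0 1) x *\<^sub>R partial_deriv i F x"
      using AE_norm_ne_1 by eventually_elim (rule lim)
    show "AE x in lborel. norm (D n x) \<le> indicator (cball 0 2) x *\<^sub>R (5 * K1 + K2)" for n
      by (intro AE_I2 bound)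
  qed
  then show ?thesis
    unfolding D0 F_def set_lebesgue_integral_def by (simp add: LIMSEQ_const_iff)
qed

text \<open>
  Green's identity with the weight \<open>1 - |x|^2\<close>.  For \<open>G = Y \<nabla>Z - Z \<nabla>Y\<close> the divergence of \<open>G\<close> vanishes
  and \<open>x \<cdot> G = (l - k) Y Z\<close> by Euler's identity, so the divergence of \<open>(1 - |x|^2) G\<close> is
  \<open>2 (k - l) Y Z\<close>; its integral over the ball is zero.
\<close>

lemma integral_ball_harmonic_orthogonal:
  fixes Y Z :: "real^'d::finite \<Rightarrow> real"
  assumes Y: "Y \<in> harmonic_space k" and Z: "Z \<in> harmonic_space l" and "k \<noteq> l"
  shows "(LINT x:cball 0 1|lborel. Y x * Z x) = 0"
proof -
  have YZ: "Y \<in> homogeneous_space k" "Z \<in> homogeneous_space l" "\<And>x. laplacian Y x = 0" "\<And>x. laplacian Z x = 0"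
    using Y Z by (auto simp: harmonic_space_def)
  then have Yp: "Y \<in> polyfuns" and Zp: "Z \<in> polyfuns" using homogeneous_subset_polyfuns by blast+
  define G where "G i x = Y x * partial_deriv i Z x - Z x * partial_deriv i Y x" for i x
  define H where "H i = partial_deriv i (\<lambda>y. (1 - (norm y)\<^sup>2) * G i y)" for i
  have Gp: "G i \<in> polyfuns" for i
    unfolding G_def[abs_def] by (intro polyfuns_diff polyfuns_mult polyfuns_partial_deriv Yp Zp)
  have sub: "partial_deriv i (\<lambda>x. f x - g x) = (\<lambda>x. partial_deriv i f x - partial_deriv i g x)"
    if "f \<in> polyfuns" "g \<in> polyfuns" for i and f g :: "real^'d \<Rightarrow> real"
    using partial_deriv_add[OF that(1) polyfuns_cmult[OF that(2), of "-1"], of i]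
      partial_deriv_cmult[OF that(2), of i "-1"] by simp
  have dG: "partial_deriv i (G i) x = Y x * partial_deriv i (partial_deriv i Z) x -
      Z x * partial_deriv i (partial_deriv i Y) x" for i x
    unfolding G_def[abs_def]
    by (simp add: sub partial_deriv_mult polyfuns_mult polyfuns_partial_deriv Yp Zp)
  have H: "H i x = -2 * x $ i * G i x + (1 - (norm x)\<^sup>2) * partial_deriv i (G i) x" for i x
    unfolding H_def
    by (simp add: sub partial_deriv_mult Gp polyfuns_intros partial_deriv_norm_sq partial_deriv_const)
  have "(\<Sum>i\<in>UNIV. H i x) = 2 * (real k - real l) * (Y x * Z x)" for x
  proof -
    have "(\<Sum>i\<in>UNIV. partial_deriv i (G i) x) = Y x * laplacian Z x - Z x * laplacian Y x"
      by (simp add: dG laplacian_def sum_subtractf sum_distrib_left)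
    moreover have "(\<Sum>i\<in>UNIV. x $ i * G i x) = Y x * euler Z x - Z x * euler Y x"
      by (simp add: G_def euler_def sum_subtractf sum_distrib_left algebra_simps)
    moreover have "(\<Sum>i\<in>UNIV. H i x) = -2 * (\<Sum>i\<in>UNIV. x $ i * G i x) +
        (1 - (norm x)\<^sup>2) * (\<Sum>i\<in>UNIV. partial_deriv i (G i) x)"
      by (simp only: H sum.distrib sum_distrib_left mult.assoc)
    ultimately show ?thesis
      by (simp add: YZ(3,4) euler_homogeneous[OF YZ(1)] euler_homogeneous[OF YZ(2)] algebra_simps)
  qed
  then have "2 * (real k - real l) * (LINT x:cball 0 1|lborel. Y x * Z x) =
      (LINT x:cball 0 1|lborel. (\<Sum>i\<in>UNIV. H i x))"
    by (simp add: mult.assoc)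
  also have "\<dots> = (\<Sum>i\<in>UNIV. (LINT x:cball 0 1|lborel. H i x))"
    unfolding set_lebesgue_integral_def scaleR_sum_right
  proof (rule Bochner_Integration.integral_sum)
    fix i
    have "H i \<in> polyfuns" unfolding H_def by (intro polyfuns_partial_deriv polyfuns_intros Gp)
    then show "integrable lborel (\<lambda>x. indicator (cball 0 1) x *\<^sub>R H i x)"
      using polyfun_integrable_cball unfolding set_integrable_def by blast
  qed
  also have "\<dots> = 0"
    unfolding H_def by (simp add: integral_ball_partial_deriv[OF Gp])
  finally show ?thesis using assms(3) by simp
qed

section \<open>Polar coordinates for homogeneous functions\<close>

lemma integral_lborel_scaleR:
  fixes f :: "real^'d::finite \<Rightarrow> real"
  assumes f: "f \<in> borel_measurable borel" and c: "c > 0"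
  shows "(LINT x|lborel. f x) = c ^ CARD('d) * (LINT x|lborel. f (c *\<^sub>R x))"
proof -
  let ?D = "distr lborel borel (\<lambda>x::real^'d. c *\<^sub>R x)"
  have L: "lborel = density ?D (\<lambda>_. ennreal (c ^ CARD('d)))"
    using lborel_affine[of c "0::real^'d"] c by simp
  have "(LINT x|lborel. f x) = (LINT x|density ?D (\<lambda>_. ennreal (c ^ CARD('d))). f x)"
    by (rule arg_cong[OF L, of "\<lambda>M. integral\<^sup>L M f"])
  also have "\<dots> = (LINT x|?D. c ^ CARD('d) *\<^sub>R f x)"
    using f c by (intro integral_density) auto
  also have "\<dots> = (LINT x|lborel. c ^ CARD('d) *\<^sub>R f (c *\<^sub>R x))"
    using f by (intro integral_distr) auto
  finally show ?thesis by simp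
qed

text \<open>
  Let \<open>J s r\<close> be the integral of \<open>|x|^s \<phi>\<close> over the ball of radius \<open>r\<close>; scaling gives
  \<open>J s r = r^(d+s) J s 1\<close>.  On the shell \<open>r < |x| \<le> 1\<close> the factor \<open>|x|^s\<close> lies between \<open>r^s\<close> and \<open>1\<close>,
  hence \<open>r^s (1 - r^d) J 0 1 \<le> (1 - r^(d+s)) J s 1 \<le> (1 - r^d) J 0 1\<close>.  Dividing by \<open>1 - r\<close> and letting
  \<open>r\<close> tend to \<open>1\<close> turns the factors into \<open>d\<close> and \<open>d + s\<close>.
\<close>

lemma integral_ball_norm_power_nonneg:
  fixes \<phi> :: "real^'d::finite \<Rightarrow> real"
  assumes meas [measurable]: "\<phi> \<in> borel_measurable borel"
    and nonneg: "\<And>x. 0 \<le> \<phi> x" and bounded: "\<And>x. \<phi> x \<le> C"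
    and hom: "\<And>c x. c > 0 \<Longrightarrow> \<phi> (c *\<^sub>R x) = \<phi> x"
  shows "real (CARD('d) + s) * (LINT x:cball 0 1|lborel. norm x ^ s * \<phi> x) =
    real CARD('d) * (LINT x:cball 0 1|lborel. \<phi> x)"
proof -
  let ?d = "CARD('d)"
  define F where "F k r x = indicator (cball 0 r) x *\<^sub>R (norm x ^ k * \<phi> x)" for k r x
  define J where "J k r = (LINT x|lborel. F k r x)" for k r
  have [measurable]: "cball (0::real^'d) r \<in> sets borel" for r by simp
  have F_meas [measurable]: "F k r \<in> borel_measurable borel" for k r
    unfolding F_def by measurable
  have F_int: "integrable lborel (F k r)" if "r \<le> 1" for k r
  proof (rule Bochner_Integration.integrable_bound)
    show "integrable lborel (\<lambda>x::real^'d. indicator (cball 0 1) x *\<^sub>R C)"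
      by (intro borel_integrable_compact compact_cball continuous_on_const)
    have "norm x ^ k * \<phi> x \<le> 1 * C" if "norm x \<le> 1" for x
      using that nonneg bounded by (intro mult_mono power_le_one) auto
    then show "AE x in lborel. norm (F k r x) \<le> norm (indicator (cball 0 1) x *\<^sub>R C)"
      using that nonneg order_trans[OF nonneg bounded]
      by (intro AE_I2) (auto simp: F_def indicator_def)
  qed simp
  have J_scale: "J k r = r ^ (?d + k) * J k 1" if "0 < r" for k r
  proof -
    have "F k r (r *\<^sub>R x) = r ^ k * F k 1 x" for x
      using that by (simp add: F_def hom indicator_def power_mult_distrib)
    then show ?thesis
      unfolding J_def integral_lborel_scaleR[OF F_meas[of k r] that] by (simp add: power_add)
  qed
  let ?g = "\<lambda>n r::real. \<Sum>i<n. r ^ i"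
  have shell: "r ^ s * (?g ?d r * J 0 1) \<le> ?g (?d + s) r * J s 1"
      "?g (?d + s) r * J s 1 \<le> ?g ?d r * J 0 1" if r: "0 < r" "r < 1" for r
  proof -
    have split: "J k 1 - J k r = (1 - r) * (?g (?d + k) r * J k 1)" for k
    proof -
      have "J k 1 - J k r = (1 - r ^ (?d + k)) * J k 1"
        unfolding J_scale[OF r(1), of k] by (simp only: left_diff_distrib mult_1_left)
      then show ?thesis by (simp only: one_diff_power_eq mult.assoc)
    qed
    have diff: "J k 1 - J k r = (LINT x|lborel. F k 1 x - F k r x)" for k
      unfolding J_def using F_int r by simp
    have int: "integrable lborel (\<lambda>x. F k 1 x - F k r x)" for k
      using F_int r by auto
    have "r ^ s * (F 0 1 x - F 0 r x) \<le> F s 1 x - F s r x \<and> F s 1 x - F s r x \<le> F 0 1 x - F 0 r x" for x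
    proof -
      have "r ^ s * \<phi> x \<le> norm x ^ s * \<phi> x" if "r < norm x"
        using that r nonneg by (intro mult_right_mono power_mono) auto
      moreover have "norm x ^ s * \<phi> x \<le> 1 * \<phi> x" if "norm x \<le> 1"
        using that nonneg by (intro mult_right_mono power_le_one) auto
      ultimately show ?thesis using r by (auto simp: F_def indicator_def)
    qed
    then have "r ^ s * (J 0 1 - J 0 r) \<le> J s 1 - J s r" "J s 1 - J s r \<le> J 0 1 - J 0 r"
      unfolding diff integral_mult_right_zero[symmetric]
      by (intro integral_mono integrable_mult_right int; blast)+
    then show "r ^ s * (?g ?d r * J 0 1) \<le> ?g (?d + s) r * J s 1"
      "?g (?d + s) r * J s 1 \<le> ?g ?d r * J 0 1"
      unfolding split using r by (simp_all add: mult.left_commute[of _ "1 - r"])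
  qed
  have near: "eventually (\<lambda>r::real. 0 < r \<and> r < 1) (at_left 1)"
    using eventually_at_left_real[of 0 1] by simp
  have lim: "((\<lambda>r. ?g n r * c) \<longlongrightarrow> real n * c) (at_left 1)" for n c
    by (rule tendsto_eq_intros | simp)+
  have lim': "((\<lambda>r. r ^ s * (?g n r * c)) \<longlongrightarrow> real n * c) (at_left 1)" for n c
    by (rule tendsto_eq_intros lim | simp)+
  have "real ?d * J 0 1 \<le> real (?d + s) * J s 1"
    by (rule tendsto_le[OF _ lim lim']) (use near in \<open>auto elim!: eventually_mono intro: shell\<close>)
  moreover have "real (?d + s) * J s 1 \<le> real ?d * J 0 1"
    by (rule tendsto_le[OF _ lim lim]) (use near in \<open>auto elim!: eventually_mono intro: shell\<close>)
  ultimately show ?thesis by (simp add: J_def F_def set_lebesgue_integral_def)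
qed

lemma integral_surface_measure:
  fixes f :: "real^'d::finite \<Rightarrow> real"
  assumes f [measurable]: "f \<in> borel_measurable borel"
  shows "(LINT x|surface_measure. f x) = real CARD('d) * (LINT x:cball 0 1|lborel. f (sgn x))"
proof -
  let ?P = "cball (0::real^'d) 1 - {0}" and ?S = "restrict_space borel (sphere (0::real^'d) 1)"
  let ?M = "distr (restrict_space lborel ?P) ?S sgn"
  have [measurable]: "?P \<in> sets borel" "cball (0::real^'d) 1 \<in> sets borel" by auto
  have fS: "f \<in> borel_measurable ?S" using f by (rule measurable_restrict_space1)
  have "surface_measure = density ?M (\<lambda>_. ennreal (real CARD('d)))"
    unfolding surface_measure_def
    by (rule measure_eqI) (simp_all add: emeasure_density nn_integral_cmult_indicator ennreal_of_nat_eq_real_of_nat)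
  then have "(LINT x|surface_measure. f x) = (LINT x|density ?M (\<lambda>_. ennreal (real CARD('d))). f x)"
    by (rule arg_cong[of _ _ "\<lambda>M. integral\<^sup>L M f"])
  also have "\<dots> = (LINT x|?M. real CARD('d) *\<^sub>R f x)"
    using fS by (intro integral_density) auto
  also have "\<dots> = real CARD('d) * (LINT x|?M. f x)" by simp
  also have "(LINT x|?M. f x) = (LINT x|restrict_space lborel ?P. f (sgn x))"
    by (rule integral_distr[OF sgn_measurable_sphere fS])
  also have "\<dots> = (LINT x|lborel. indicator ?P x *\<^sub>R f (sgn x))"
    by (rule integral_restrict_space) simp
  also have "\<dots> = (LINT x|lborel. indicator (cball 0 1) x *\<^sub>R f (sgn x))"
  proof (rule integral_cong_AE)
    have [measurable]: "(sgn :: real^'d \<Rightarrow> _) \<in> borel_measurable borel"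
      unfolding sgn_div_norm[abs_def] by measurable
    show "(\<lambda>x. indicator ?P x *\<^sub>R f (sgn x)) \<in> borel_measurable lborel"
      "(\<lambda>x. indicator (cball 0 1) x *\<^sub>R f (sgn x)) \<in> borel_measurable lborel" by measurable
    show "AE x in lborel. indicator ?P x *\<^sub>R f (sgn x) = indicator (cball 0 1) x *\<^sub>R f (sgn x)"
      using AE_lborel_singleton[of "0::real^'d"] by eventually_elim (simp add: indicator_def)
  qed
  finally show ?thesis by (simp add: set_lebesgue_integral_def)
qed

text \<open>
  Write \<open>h = |x|^p h(x/|x|)\<close> and apply the previous comparison to the angular part.  It need not be
  nonnegative, so a constant bound \<open>C\<close> is added and its contribution subtracted again.
\<close>

lemma integral_ball_homogeneous:
  fixes h :: "real^'d::finite \<Rightarrow> real"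
  assumes h: "h \<in> homogeneous_space p"
  shows "real (CARD('d) + p) * (LINT x:cball 0 1|lborel. h x) = (LINT x|surface_measure. h x)"
proof -
  let ?d = "CARD('d)"
  have hp: "h \<in> polyfuns" using h homogeneous_subset_polyfuns by blast
  have [measurable]: "h \<in> borel_measurable borel" by (rule polyfun_borel[OF hp])
  have [measurable]: "cball (0::real^'d) 1 \<in> sets borel" by simp
  have [measurable]: "(sgn :: real^'d \<Rightarrow> _) \<in> borel_measurable borel"
    unfolding sgn_div_norm[abs_def] by measurable
  obtain C where C: "C \<ge> 0" "\<And>x. x \<in> cball 0 1 \<Longrightarrow> \<bar>h x\<bar> \<le> C"
    using polyfun_bounded_cball[OF hp] by blast
  have hC: "\<bar>h (sgn x)\<bar> \<le> C" for x by (rule C) (simp add: norm_sgn)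
  have sgn_hom: "sgn (c *\<^sub>R x) = sgn x" if "c > 0" for c and x :: "real^'d"
    using that by (simp add: sgn_scaleR)
  have h_polar: "norm x ^ p * h (sgn x) = h x" for x
    using homogeneous_scaling[OF h, of "norm x" "sgn x"] by (cases "x = 0") (simp_all add: sgn_div_norm)
  have int: "set_integrable lborel (cball 0 1) (\<lambda>x::real^'d. norm x ^ q)" for q
    unfolding set_integrable_def by (intro borel_integrable_compact compact_cball continuous_intros)
  have int_h: "set_integrable lborel (cball 0 1) (\<lambda>x. h (sgn x))"
    unfolding set_integrable_def
  proof (rule Bochner_Integration.integrable_bound)
    show "integrable lborel (\<lambda>x::real^'d. indicator (cball 0 1) x *\<^sub>R C)"
      by (intro borel_integrable_compact compact_cball continuous_on_const)
    show "AE x in lborel. norm (indicator (cball 0 1) x *\<^sub>R h (sgn x)) \<le> norm (indicator (cball 0 1) x *\<^sub>R C)"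
      using hC C(1) by (intro AE_I2) (auto simp: indicator_def)
  qed measurable
  have "real (?d + p) * (LINT x:cball 0 1|lborel. norm x ^ p * (h (sgn x) + C)) =
      real ?d * (LINT x:cball 0 1|lborel. h (sgn x) + C)"
  proof (rule integral_ball_norm_power_nonneg[where C = "2 * C"])
    show "0 \<le> h (sgn x) + C" "h (sgn x) + C \<le> 2 * C" for x using hC[of x] by auto
  qed (measurable, simp add: sgn_hom)
  moreover have "real (?d + p) * (LINT x:cball 0 1|lborel. norm (x::real^'d) ^ p * C) =
      real ?d * (LINT x:cball (0::real^'d) 1|lborel. C)"
    by (rule integral_ball_norm_power_nonneg[where C = C and \<phi> = "\<lambda>_. C"]) (use C(1) in auto)
  moreover have "(LINT x:cball 0 1|lborel. norm x ^ p * (h (sgn x) + C)) =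
      (LINT x:cball 0 1|lborel. h x) + (LINT x:cball (0::real^'d) 1|lborel. norm x ^ p * C)"
    unfolding distrib_left h_polar
    by (rule set_integral_add(2)) (use polyfun_integrable_cball[OF hp] int in auto)
  moreover have "(LINT x:cball 0 1|lborel. h (sgn x) + C) =
      (LINT x:cball 0 1|lborel. h (sgn x)) + (LINT x:cball (0::real^'d) 1|lborel. C)"
    by (rule set_integral_add(2)[OF int_h polyfun_integrable_cball[OF polyfuns_const]])
  ultimately show ?thesis
    unfolding integral_surface_measure[OF \<open>h \<in> borel_measurable borel\<close>] by (simp add: algebra_simps)
qed

lemma space_surface_measure: "space surface_measure = sphere 0 1"
  by (simp add: surface_measure_def space_scale_measure space_restrict_space)

text \<open>
  Each term \<open>|x|^(2i) h\<close> is homogeneous of degree \<open>p + 2i\<close> and agrees with \<open>h\<close> on the sphere; it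
  contributes \<open>1/(d + p + 2i)\<close>, which is half the \<open>i\<close>-th moment for the exponent \<open>b = (p + d)/2 - 1\<close>.
\<close>

lemma integral_ball_radial_homogeneous:
  fixes h :: "real^'d::finite \<Rightarrow> real"
  assumes h: "h \<in> homogeneous_space p"
  shows "(LINT x:cball 0 1|lborel. poly g ((norm x)\<^sup>2) * h x) =
    moment ((real p + real CARD('d)) / 2 - 1) g / 2 * (LINT x|surface_measure. h x)"
proof -
  let ?S = "LINT x|surface_measure. h x" and ?b = "(real p + real CARD('d)) / 2 - 1"
  define H where "H i x = ((norm x)\<^sup>2) ^ i * h x" for i x
  have Hh: "H i \<in> homogeneous_space (p + 2 * i)" for i
    unfolding H_def[abs_def] by (rule homogeneous_norm_power[OF h])
  have *: "(LINT x|surface_measure. H i x) = ?S" for i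
    by (rule Bochner_Integration.integral_cong) (simp_all add: space_surface_measure H_def)
  have HI: "(LINT x:cball 0 1|lborel. H i x) = ?S / real (CARD('d) + (p + 2 * i))" for i
  proof -
    have "CARD('d) + (p + 2 * i) \<noteq> 0" by simp
    then have "real (CARD('d) + (p + 2 * i)) \<noteq> 0" by (simp only: of_nat_eq_0_iff not_False_eq_True)
    with integral_ball_homogeneous[OF Hh[of i]] * show ?thesis by (metis nonzero_mult_div_cancel_left)
  qed
  have Hint: "integrable lborel (\<lambda>x. indicator (cball 0 1) x *\<^sub>R (coeff g i * H i x))" for i
    using polyfun_integrable_cball[OF polyfuns_cmult[OF subsetD[OF homogeneous_subset_polyfuns Hh[of i]]]]
    by (simp add: set_integrable_def)
  have "(LINT x:cball 0 1|lborel. poly g ((norm x)\<^sup>2) * h x) =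
      (LINT x:cball 0 1|lborel. \<Sum>i\<le>degree g. coeff g i * H i x)"
    by (simp add: poly_altdef sum_distrib_right H_def mult.assoc)
  also have "\<dots> = (\<Sum>i\<le>degree g. LINT x:cball 0 1|lborel. coeff g i * H i x)"
    unfolding set_lebesgue_integral_def scaleR_sum_right
    by (rule Bochner_Integration.integral_sum) (rule Hint)
  also have "\<dots> = (\<Sum>i\<le>degree g. coeff g i / (real i + ?b + 1) / 2 * ?S)"
  proof (intro sum.cong refl)
    fix i
    have "real i + ?b + 1 = real (CARD('d) + (p + 2 * i)) / 2" by (simp add: field_simps)
    then show "(LINT x:cball 0 1|lborel. coeff g i * H i x) = coeff g i / (real i + ?b + 1) / 2 * ?S"
      by (simp add: HI set_integral_mult_right)
  qed
  also have "\<dots> = moment ?b g / 2 * ?S"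
    by (simp add: moment_def sum_distrib_right sum_divide_distrib)
  finally show ?thesis .
qed

section \<open>The Sobolev inner product on radial multiples of harmonics\<close>

lemma sphere_area_eq: "sphere_area CARD('d) = real CARD('d) * measure lborel (cball (0::real^'d::finite) 1)"
proof -
  have "sphere_area CARD('d) = (LINT x|(surface_measure :: (real^'d) measure). 1)"
    by (simp add: measure_surface_measure_sphere space_surface_measure)
  also have "\<dots> = real CARD('d) * (LINT x:cball (0::real^'d) 1|lborel. 1)"
    by (rule integral_surface_measure) simp
  finally show ?thesis by (simp add: set_lebesgue_integral_def)
qed

lemma measure_cball_pos: "measure lborel (cball (0::real^'d::finite) 1) > 0"
  by (simp add: content_cball_pos)

text \<open>
  The basis polynomial attached to an arbitrary function \<open>Y\<close>, indexed by the degree \<open>k\<close> of the harmonic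
  factor in place of the total degree \<open>k + 2j\<close>.
\<close>

definition radial_multiple :: "nat \<Rightarrow> nat \<Rightarrow> (real^'d::finite \<Rightarrow> real) \<Rightarrow> real^'d \<Rightarrow> real" where
  "radial_multiple k j Y x = poly (radial_factor (radial_index k TYPE('d)) j) ((norm x)\<^sup>2) * Y x"

lemma sobolev_Q_eq_radial_multiple:
  assumes "2 * j \<le> n"
  shows "sobolev_Q Y n j \<nu> = radial_multiple (n - 2 * j) j (Y (n - 2 * j) \<nu>)"
proof -
  have "real n - 2 * real j + (real CARD('a) - 2) / 2 = radial_index (n - 2 * j) TYPE('a)"
    using assms by (simp add: radial_index_def of_nat_diff)
  then show ?thesis
    by (simp add: fun_eq_iff sobolev_Q_def radial_multiple_def radial_factor_def poly_pcompose algebra_simps)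
qed

lemma laplacian_radial_multiple:
  fixes Y :: "real^'d::finite \<Rightarrow> real"
  assumes "Y \<in> harmonic_space k"
  shows "laplacian (\<lambda>y. (1 - (norm y)\<^sup>2) * radial_multiple k j Y y) x =
    poly (radial_image (radial_index k TYPE('d)) j) ((norm x)\<^sup>2) * Y x"
proof -
  have "(\<lambda>y. (1 - (norm y)\<^sup>2) * radial_multiple k j Y y) =
      (\<lambda>y. poly ([:1, -1:] * radial_factor (radial_index k TYPE('d)) j) ((norm y)\<^sup>2) * Y y)"
    by (simp add: fun_eq_iff radial_multiple_def algebra_simps)
  then show ?thesis
    by (simp only: laplacian_radial[OF assms] radial_image_def)
qed

text \<open>
  The squared norms as functions of the dimension \<open>d\<close>, the total degree \<open>n\<close> and the index \<open>j\<close>.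
\<close>

definition sobolev_norm_sq :: "real \<Rightarrow> nat \<Rightarrow> nat \<Rightarrow> real" where
  "sobolev_norm_sq d n j =
     (if j = 0 then (2 * real n + d) / d else 2 * (real j)\<^sup>2 * (real j + 1)\<^sup>2 / (d * (real n + d / 2)))"

text \<open>
  For \<open>k \<noteq> l\<close> the spherical factor vanishes, for \<open>k = l\<close> and \<open>i \<noteq> j\<close> the radial moment does.  In the
  remaining case the constant \<open>1/(4 d^2 vol)\<close>, the \<open>1/2\<close> from polar coordinates and
  \<open>\<omega> = d vol\<close> combine to \<open>1/(8d)\<close> times the moment of the square.
\<close>

lemma sobolev_inner_radial_multiple:
  fixes Y Z :: "real^'d::finite \<Rightarrow> real"
  assumes Y: "Y \<in> harmonic_space k" and Z: "Z \<in> harmonic_space l"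
  shows "sobolev_inner (radial_multiple k i Y) (radial_multiple l j Z) =
    (if k = l \<and> i = j then sobolev_norm_sq (real CARD('d)) (k + 2 * i) i * sphere_inner Y Z else 0)"
proof -
  let ?d = "real CARD('d)" and ?v = "measure lborel (cball (0::real^'d) 1)"
  let ?a = "radial_image (radial_index k TYPE('d)) i" and ?b = "radial_image (radial_index l TYPE('d)) j"
  let ?S = "LINT x|surface_measure. Y x * Z x"
  have Yh: "Y \<in> homogeneous_space k" and Zh: "Z \<in> homogeneous_space l"
    using Y Z harmonic_subset_homogeneous by blast+
  note YZh = homogeneous_mult[OF Yh Zh]
  have eq: "sobolev_inner (radial_multiple k i Y) (radial_multiple l j Z) =
      1 / (4 * ?d\<^sup>2 * ?v) * (moment ((real (k + l) + ?d) / 2 - 1) (?a * ?b) / 2 * ?S)"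
    unfolding sobolev_inner_def laplacian_radial_multiple[OF Y] laplacian_radial_multiple[OF Z]
      integral_ball_radial_homogeneous[OF YZh, symmetric]
    by (simp add: mult_ac)
  show ?thesis
  proof (cases "k = l")
    case False
    have "?S = 0"
      using integral_ball_homogeneous[OF YZh] integral_ball_harmonic_orthogonal[OF Y Z False] by simp
    then show ?thesis unfolding eq using False by simp
  next
    case True
    note kl = this
    define b where "b = radial_index k TYPE('d)"
    have b: "b > -1" unfolding b_def by (rule radial_index_gt)
    have ix: "(real (k + l) + ?d) / 2 - 1 = b"
      using True by (simp add: b_def radial_index_def field_simps)
    have d: "?d > 0" and v: "?v > 0" using measure_cball_pos by simp_all
    have S: "?S = ?d * ?v * sphere_inner Y Z"
      using d v unfolding sphere_inner_def sphere_area_eq by simp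
    have inner: "sobolev_inner (radial_multiple k i Y) (radial_multiple l j Z) =
        moment b (radial_image b i * radial_image b j) / (8 * ?d) * sphere_inner Y Z"
      unfolding eq ix S using d v True by (simp add: b_def power2_eq_square field_simps)
    have diagonal: "moment b (radial_image b i * radial_image b i) / (8 * ?d) = sobolev_norm_sq ?d (k + 2 * i) i"
    proof (cases "i = 0")
      case True
      have "b + 1 = (2 * real k + ?d) / 2" by (simp add: b_def radial_index_def field_simps)
      then have "moment b (radial_image b 0 * radial_image b 0) = 8 * (2 * real k + ?d)"
        by (simp add: moment_radial_image_square[OF b])
      with True d show ?thesis by (simp add: sobolev_norm_sq_def field_simps)
    next
      case False
      have e: "2 * real i + b + 1 = real (k + 2 * i) + ?d / 2"
        by (simp add: b_def radial_index_def field_simps)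
      have cancel: "16 * x * y / z / (8 * ?d) = 2 * x * y / (?d * z)" for x y z :: real
        by (simp add: mult_ac)
      show ?thesis
        unfolding moment_radial_image_square[OF b] e sobolev_norm_sq_def
        using False by (simp only: if_False cancel)
    qed
    show ?thesis
    proof (cases "i = j")
      case True
      have "sobolev_inner (radial_multiple k i Y) (radial_multiple l j Z) =
          sobolev_norm_sq ?d (k + 2 * i) i * sphere_inner Y Z"
        unfolding inner unfolding True[symmetric] diagonal ..
      with True kl show ?thesis by simp
    next
      case False
      then show ?thesis unfolding inner by (simp add: moment_radial_image_orthogonal[OF b False])
    qed
  qed
qed

lemma sobolev_norm_sq_pos: "d > 0 \<Longrightarrow> sobolev_norm_sq d n j > 0"
  by (auto simp: sobolev_norm_sq_def intro!: divide_pos_pos mult_pos_pos add_nonneg_pos)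

section \<open>Orthogonal families for the Sobolev inner product\<close>

lemma sobolev_inner_commute: "sobolev_inner f g = sobolev_inner g f"
  by (simp add: sobolev_inner_def mult.commute)

lemma polyfuns_bubble: "f \<in> polyfuns \<Longrightarrow> (\<lambda>y. (1 - (norm y)\<^sup>2) * f y) \<in> polyfuns"
  by (intro polyfuns_intros)

lemma sobolev_inner_linear_left:
  assumes f: "f \<in> polyfuns" and g: "g \<in> polyfuns" and h: "h \<in> polyfuns"
  shows "sobolev_inner (c *\<^sub>R f + g) h = c * sobolev_inner f h + sobolev_inner g h"
proof -
  let ?T = "\<lambda>f. laplacian (\<lambda>y. (1 - (norm y)\<^sup>2) * f y)"
  have "(\<lambda>y. (1 - (norm y)\<^sup>2) * (c *\<^sub>R f + g) y) = (\<lambda>y. c * ((1 - (norm y)\<^sup>2) * f y) + (1 - (norm y)\<^sup>2) * g y)"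
    by (simp add: fun_eq_iff algebra_simps)
  then have T: "?T (c *\<^sub>R f + g) x = c * ?T f x + ?T g x" for x
    by (simp only: laplacian_add laplacian_cmult polyfuns_cmult polyfuns_bubble f g)
  have int: "set_integrable lborel (cball 0 1) (\<lambda>x. ?T p x * ?T q x)" if "p \<in> polyfuns" "q \<in> polyfuns" for p q
    by (intro polyfun_integrable_cball polyfuns_mult polyfuns_laplacian polyfuns_bubble that)
  have "(LINT x:cball 0 1|lborel. ?T (c *\<^sub>R f + g) x * ?T h x) =
      (LINT x:cball 0 1|lborel. c * (?T f x * ?T h x) + ?T g x * ?T h x)"
    unfolding T by (simp add: algebra_simps)
  also have "\<dots> = c * (LINT x:cball 0 1|lborel. ?T f x * ?T h x) + (LINT x:cball 0 1|lborel. ?T g x * ?T h x)"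
    by (subst set_integral_add(2)) (use int[OF f h] int[OF g h] in auto)
  finally show ?thesis by (simp add: sobolev_inner_def distrib_left add_divide_distrib)
qed

lemma sobolev_inner_0 [simp]: "sobolev_inner 0 h = 0"
proof -
  have "laplacian (\<lambda>x::real^'a. 0) x = 0" for x by (simp add: laplacian_def partial_deriv_const)
  then show ?thesis by (simp add: sobolev_inner_def)
qed

lemma span_subset_polyfuns: "A \<subseteq> polyfuns \<Longrightarrow> span A \<subseteq> polyfuns"
  by (rule span_minimal[OF _ subspace_polyfuns])

lemma sobolev_inner_span_left_zero:
  assumes A: "A \<subseteq> polyfuns" and q: "q \<in> polyfuns" and 0: "\<And>a. a \<in> A \<Longrightarrow> sobolev_inner a q = 0"
    and p: "p \<in> span A"
  shows "sobolev_inner p q = 0"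
proof -
  have "p \<in> polyfuns \<and> sobolev_inner p q = 0"
    using p
  proof (induction rule: span_induct_alt)
    case base
    show ?case using sobolev_inner_0 subspace_0[OF subspace_polyfuns] by blast
  next
    case (step c a g)
    have a: "a \<in> polyfuns" using step(1) A by blast
    have "c *\<^sub>R a + g \<in> polyfuns"
      using a step(2) by (intro subspace_add[OF subspace_polyfuns] subspace_scale[OF subspace_polyfuns]) auto
    moreover have "sobolev_inner (c *\<^sub>R a + g) q = 0"
      using step(2) 0[OF step(1)] by (simp add: sobolev_inner_linear_left[OF a _ q] del: scaleR_fun_apply)
    ultimately show ?case ..
  qed
  then show ?thesis ..
qed

lemma sobolev_inner_span_zero:
  assumes A: "A \<subseteq> polyfuns" and B: "B \<subseteq> polyfuns"
    and 0: "\<And>a b. a \<in> A \<Longrightarrow> b \<in> B \<Longrightarrow> sobolev_inner a b = 0"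
    and p: "p \<in> span A" and q: "q \<in> span B"
  shows "sobolev_inner p q = 0"
proof (rule sobolev_inner_span_left_zero[OF A _ _ p])
  show q': "q \<in> polyfuns" using q span_subset_polyfuns[OF B] by blast
  fix a assume a: "a \<in> A"
  have "sobolev_inner q a = 0"
    by (rule sobolev_inner_span_left_zero[OF B _ _ q]) (use a A 0 in \<open>auto simp: sobolev_inner_commute[of _ a]\<close>)
  then show "sobolev_inner a q = 0" by (simp add: sobolev_inner_commute)
qed

text \<open>
  The coefficients of a combination of an orthogonal family are recovered by inner products.
\<close>

lemma sobolev_inner_sum_orthogonal:
  assumes "finite t" "t \<subseteq> A" "w \<in> A" and A: "A \<subseteq> polyfuns"
    and orth: "\<And>v. v \<in> A \<Longrightarrow> v \<noteq> w \<Longrightarrow> sobolev_inner v w = 0"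
  shows "sobolev_inner (\<Sum>v\<in>t. r v *\<^sub>R v) w = (if w \<in> t then r w * sobolev_inner w w else 0)"
  using assms(1,2)
proof (induction t rule: finite_induct)
  case empty
  show ?case by (simp only: sum.empty sobolev_inner_0 empty_iff if_False)
next
  case (insert v t)
  have "(\<Sum>v\<in>t. r v *\<^sub>R v) \<in> span A"
    using insert.prems by (intro span_sum span_scale span_base) auto
  then have "(\<Sum>v\<in>t. r v *\<^sub>R v) \<in> polyfuns" using span_subset_polyfuns[OF A] by blast
  moreover have "v \<in> polyfuns" "w \<in> polyfuns" using insert.prems A assms(3) by auto
  moreover have "sobolev_inner (\<Sum>v\<in>t. r v *\<^sub>R v) w = (if w \<in> t then r w * sobolev_inner w w else 0)"
    using insert by blast
  ultimately have *: "sobolev_inner (\<Sum>v\<in>insert v t. r v *\<^sub>R v) w =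
      r v * sobolev_inner v w + (if w \<in> t then r w * sobolev_inner w w else 0)"
    by (simp only: sum.insert[OF insert.hyps(1,2)] sobolev_inner_linear_left)
  show ?case unfolding * using insert.hyps insert.prems orth[of v] by auto
qed

lemma sobolev_orthogonal_independent:
  assumes A: "A \<subseteq> polyfuns" and orth: "\<And>v w. v \<in> A \<Longrightarrow> w \<in> A \<Longrightarrow> v \<noteq> w \<Longrightarrow> sobolev_inner v w = 0"
    and nz: "\<And>v. v \<in> A \<Longrightarrow> sobolev_inner v v \<noteq> 0"
  shows "independent A"
proof
  assume "dependent A"
  then obtain t r v where t: "finite t" "t \<subseteq> A" "v \<in> t" "r v \<noteq> 0" "(\<Sum>v\<in>t. r v *\<^sub>R v) = 0"
    unfolding dependent_explicit by blast
  have "v \<in> A" using t by blast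
  from sobolev_inner_sum_orthogonal[OF t(1,2) this A orth, of r] t
  have "r v * sobolev_inner v v = sobolev_inner 0 v" using \<open>v \<in> A\<close> by (metis (no_types, lifting))
  with t(4) nz[OF \<open>v \<in> A\<close>] show False by (simp only: sobolev_inner_0) simp
qed

lemma sobolev_orthogonal_span_eq_0:
  assumes A: "A \<subseteq> polyfuns" and orth: "\<And>v w. v \<in> A \<Longrightarrow> w \<in> A \<Longrightarrow> v \<noteq> w \<Longrightarrow> sobolev_inner v w = 0"
    and nz: "\<And>v. v \<in> A \<Longrightarrow> sobolev_inner v v \<noteq> 0"
    and c: "c \<in> span A" and 0: "\<And>v. v \<in> A \<Longrightarrow> sobolev_inner c v = 0"
  shows "c = 0"
proof -
  from c obtain t r where t: "finite t" "t \<subseteq> A" "c = (\<Sum>v\<in>t. r v *\<^sub>R v)"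
    unfolding span_explicit by blast
  have "r v = 0" if v: "v \<in> t" for v
  proof -
    have "v \<in> A" using v t by blast
    from sobolev_inner_sum_orthogonal[OF t(1,2) this A orth, of r] 0[OF this] nz[OF this] v \<open>v \<in> A\<close>
    show ?thesis by (auto simp: t(3))
  qed
  then show ?thesis unfolding t(3) by (intro sum.neutral) simp
qed

section \<open>The orthogonal basis\<close>

locale harmonic_basis =
  fixes Y :: "nat \<Rightarrow> nat \<Rightarrow> real^'d::finite \<Rightarrow> real" and \<sigma> :: "nat \<Rightarrow> nat"
  assumes basis: "is_basis_family {1..\<sigma> m} (Y m) (harmonic_space m)"
    and orthonormal: "\<mu> \<in> {1..\<sigma> m} \<Longrightarrow> \<nu> \<in> {1..\<sigma> m} \<Longrightarrow>
      sphere_inner (Y m \<mu>) (Y m \<nu>) = (if \<mu> = \<nu> then 1 else 0)"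
begin

definition indices :: "nat \<Rightarrow> (nat \<times> nat) set" where
  "indices n = (SIGMA j:{0..n div 2}. {1..\<sigma> (n - 2 * j)})"

definition Q_set :: "nat \<Rightarrow> (real^'d \<Rightarrow> real) set" where
  "Q_set n = (\<lambda>(j, \<nu>). sobolev_Q Y n j \<nu>) ` indices n"

lemma harmonic_span: "span (Y m ` {1..\<sigma> m}) = harmonic_space m"
  using basis by (simp add: is_basis_family_def)

lemma harmonic_Y: "\<nu> \<in> {1..\<sigma> m} \<Longrightarrow> Y m \<nu> \<in> harmonic_space m"
  by (metis harmonic_span imageI span_base)

lemma sobolev_inner_Q:
  assumes "(i, \<mu>) \<in> indices m" "(j, \<nu>) \<in> indices n"
  shows "sobolev_inner (sobolev_Q Y m i \<mu>) (sobolev_Q Y n j \<nu>) =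
    (if m = n \<and> i = j \<and> \<mu> = \<nu> then sobolev_norm_sq (real CARD('d)) n j else 0)"
proof -
  have le: "2 * i \<le> m" "2 * j \<le> n" and \<mu>: "\<mu> \<in> {1..\<sigma> (m - 2 * i)}" and \<nu>: "\<nu> \<in> {1..\<sigma> (n - 2 * j)}"
    using assms by (auto simp: indices_def)
  show ?thesis
    unfolding sobolev_Q_eq_radial_multiple[OF le(1)] sobolev_Q_eq_radial_multiple[OF le(2)]
      sobolev_inner_radial_multiple[OF harmonic_Y[OF \<mu>] harmonic_Y[OF \<nu>]]
    using le orthonormal[of \<mu> "m - 2 * i" \<nu>] \<mu> \<nu> by auto
qed

lemma Q_set_poly_space: "Q_set n \<subseteq> poly_space n"
proof
  fix q assume "q \<in> Q_set n"
  then obtain j \<nu> where "(j, \<nu>) \<in> indices n" and q: "q = sobolev_Q Y n j \<nu>"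
    by (auto simp: Q_set_def)
  then have j: "2 * j \<le> n" and \<nu>: "\<nu> \<in> {1..\<sigma> (n - 2 * j)}" by (auto simp: indices_def)
  have "(n - 2 * j) + 2 * degree (radial_factor (radial_index (n - 2 * j) TYPE('d)) j) \<le> n"
    using j by (simp add: degree_radial_factor radial_index_gt)
  from radial_poly_space[OF subsetD[OF harmonic_subset_homogeneous harmonic_Y[OF \<nu>]] this]
  show "q \<in> poly_space n"
    unfolding q sobolev_Q_eq_radial_multiple[OF j] radial_multiple_def[abs_def] .
qed

lemma Q_set_polyfuns: "Q_set n \<subseteq> polyfuns"
  using Q_set_poly_space poly_space_subset_polyfuns by blast

text \<open>
  The radial factors form a triangular system: the one with index \<open>i\<close> has degree exactly \<open>i\<close>, so
  subtracting a multiple of it removes the coefficient of degree \<open>i\<close>.  The hypothesis on \<open>g\<close> says that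
  \<open>g\<close> has degree less than \<open>i\<close>, or is zero; the total degree is then at most \<open>k + 2 (i - 1)\<close>.
\<close>

lemma radial_in_span_Q:
  assumes \<nu>: "\<nu> \<in> {1..\<sigma> k}" and "k + 2 * i \<le> n + 2" and "\<And>m. m \<ge> i \<Longrightarrow> coeff g m = 0"
  shows "(\<lambda>x. poly g ((norm x)\<^sup>2) * Y k \<nu> x) \<in> span (\<Union>m\<le>n. Q_set m)"
  using assms(2,3)
proof (induction i arbitrary: g)
  case 0
  then have "g = 0" by (simp add: poly_eq_iff)
  then have "(\<lambda>x. poly g ((norm x)\<^sup>2) * Y k \<nu> x) = 0" by (simp add: fun_eq_iff)
  then show ?case by (metis span_zero)
next
  case (Suc i)
  let ?r = "radial_factor (radial_index k TYPE('d)) i"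
  have r: "degree ?r = i" "?r \<noteq> 0" by (simp_all add: degree_radial_factor radial_index_gt)
  then have lead: "coeff ?r i \<noteq> 0" by (metis leading_coeff_0_iff)
  define c where "c = coeff g i / coeff ?r i"
  define q where "q = sobolev_Q Y (k + 2 * i) i \<nu>"
  have q: "q = (\<lambda>x. poly ?r ((norm x)\<^sup>2) * Y k \<nu> x)"
    using sobolev_Q_eq_radial_multiple[of i "k + 2 * i" Y \<nu>]
    by (simp add: q_def radial_multiple_def[abs_def])
  have "(i, \<nu>) \<in> indices (k + 2 * i)" using \<nu> by (simp add: indices_def)
  then have "q \<in> Q_set (k + 2 * i)" unfolding q_def Q_set_def by force
  then have "q \<in> span (\<Union>m\<le>n. Q_set m)"
    using Suc.prems(1) by (intro span_base) auto
  moreover have "coeff (g - smult c ?r) m = 0" if "m \<ge> i" for m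
    using that Suc.prems(2)[of m] r lead by (cases "m = i") (auto simp: c_def coeff_eq_0)
  then have "(\<lambda>x. poly (g - smult c ?r) ((norm x)\<^sup>2) * Y k \<nu> x) \<in> span (\<Union>m\<le>n. Q_set m)"
    using Suc.prems(1) by (intro Suc.IH) auto
  ultimately have "c *\<^sub>R q + (\<lambda>x. poly (g - smult c ?r) ((norm x)\<^sup>2) * Y k \<nu> x) \<in> span (\<Union>m\<le>n. Q_set m)"
    by (intro span_add span_scale)
  moreover have "c *\<^sub>R q + (\<lambda>x. poly (g - smult c ?r) ((norm x)\<^sup>2) * Y k \<nu> x) =
      (\<lambda>x. poly g ((norm x)\<^sup>2) * Y k \<nu> x)"
    by (simp add: q fun_eq_iff algebra_simps)
  ultimately show ?case by (metis (no_types, lifting))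
qed

lemma harmonic_multiples_in_span_Q:
  assumes "m \<le> n" shows "harmonic_multiples m \<subseteq> span (\<Union>l\<le>n. Q_set l)"
proof
  fix f :: "real^'d \<Rightarrow> real" assume "f \<in> harmonic_multiples m"
  then obtain i k Z where f: "f = (\<lambda>x. ((norm x)\<^sup>2) ^ i * Z x)"
    and Z: "Z \<in> harmonic_space k" and m: "k + 2 * i = m"
    by (auto simp: harmonic_multiples_def)
  show "f \<in> span (\<Union>l\<le>n. Q_set l)"
    unfolding f
  proof (rule span_mult)
    show "(\<lambda>x::real^'d. ((norm x)\<^sup>2) ^ i) \<in> span {\<lambda>x. ((norm x)\<^sup>2) ^ i}" by (rule span_base) simp
    show "Z \<in> span (Y k ` {1..\<sigma> k})" using Z unfolding harmonic_span .
    fix a b :: "real^'d \<Rightarrow> real"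
    assume "a \<in> {\<lambda>x. ((norm x)\<^sup>2) ^ i}" "b \<in> Y k ` {1..\<sigma> k}"
    then obtain \<nu> where \<nu>: "\<nu> \<in> {1..\<sigma> k}" and ab: "a = (\<lambda>x. ((norm x)\<^sup>2) ^ i)" "b = Y k \<nu>" by auto
    have "(\<lambda>x. poly (monom 1 i) ((norm x)\<^sup>2) * Y k \<nu> x) \<in> span (\<Union>l\<le>n. Q_set l)"
      by (rule radial_in_span_Q[OF \<nu>, of "Suc i"]) (use m assms in auto)
    then show "(\<lambda>x. a x * b x) \<in> span (\<Union>l\<le>n. Q_set l)" by (simp add: ab poly_monom)
  qed
qed

lemma poly_space_subset_span_Q: "poly_space n \<subseteq> span (\<Union>m\<le>n. Q_set m)"
  unfolding poly_space_def
proof (rule span_minimal)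
  show "{monomial_fun k |k. sum k UNIV \<le> n} \<subseteq> span (\<Union>m\<le>n. Q_set m)"
  proof clarify
    fix k :: "'d \<Rightarrow> nat" assume k: "sum k UNIV \<le> n"
    have "monomial_fun k \<in> homogeneous_space (sum k UNIV)"
      unfolding homogeneous_space_def by (rule span_base) blast
    then show "monomial_fun k \<in> span (\<Union>m\<le>n. Q_set m)"
      unfolding homogeneous_eq_harmonic_multiples
      using span_minimal[OF harmonic_multiples_in_span_Q[OF k] subspace_span] by blast
  qed
qed simp

lemma sobolev_inner_Q_set:
  assumes "v \<in> Q_set m" "w \<in> Q_set n"
  shows "v \<noteq> w \<or> m \<noteq> n \<Longrightarrow> sobolev_inner v w = 0" and "sobolev_inner v v \<noteq> 0"
proof -
  obtain i \<mu> j \<nu> where v: "(i, \<mu>) \<in> indices m" "v = sobolev_Q Y m i \<mu>"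
    and w: "(j, \<nu>) \<in> indices n" "w = sobolev_Q Y n j \<nu>"
    using assms by (auto simp: Q_set_def)
  show "v \<noteq> w \<or> m \<noteq> n \<Longrightarrow> sobolev_inner v w = 0"
    using sobolev_inner_Q[OF v(1) w(1)] v w by auto
  show "sobolev_inner v v \<noteq> 0"
    using sobolev_inner_Q[OF v(1) v(1)] sobolev_norm_sq_pos[of "real CARD('d)" m i] v(2) by simp
qed

text \<open>
  Expand \<open>P\<close> of degree at most \<open>n\<close> in the orthogonal polynomials of all degrees up to \<open>n\<close>, and let \<open>c\<close>
  be the part of degrees below \<open>n\<close>.  If \<open>P\<close> is orthogonal to all lower degrees then so is \<open>c\<close>, being the
  difference of \<open>P\<close> and a combination of polynomials that are; as \<open>c\<close> is itself a combination of lower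
  ones, it vanishes.
\<close>

lemma orthogonal_space_eq: "orthogonal_space n = span (Q_set n)"
proof (intro antisym subsetI)
  fix P assume P: "P \<in> span (Q_set n)"
  have "P \<in> poly_space n"
    using P span_minimal[OF Q_set_poly_space, of n] by (auto simp: poly_space_def)
  moreover have "sobolev_inner P q = 0" if "k < n" "q \<in> poly_space k" for k q
  proof (rule sobolev_inner_span_zero[OF Q_set_polyfuns _ _ P])
    show "(\<Union>m\<le>k. Q_set m) \<subseteq> polyfuns" using Q_set_polyfuns by blast
    show "q \<in> span (\<Union>m\<le>k. Q_set m)" using that poly_space_subset_span_Q by blast
    fix a b assume "a \<in> Q_set n" "b \<in> (\<Union>m\<le>k. Q_set m)"
    then show "sobolev_inner a b = 0" using that(1) sobolev_inner_Q_set(1) by fastforce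
  qed
  ultimately show "P \<in> orthogonal_space n" by (simp add: orthogonal_space_def)
next
  fix P assume P: "P \<in> (orthogonal_space n :: (real^'d \<Rightarrow> real) set)"
  let ?C = "\<Union>m<n. Q_set m"
  have "(\<Union>m\<le>n. Q_set m) = Q_set n \<union> ?C" by (auto simp: le_less)
  moreover have "P \<in> poly_space n" using P by (simp add: orthogonal_space_def)
  ultimately have "P \<in> span (Q_set n \<union> ?C)" using poly_space_subset_span_Q[of n] by auto
  then obtain a c where a: "a \<in> span (Q_set n)" and c: "c \<in> span ?C" and Pac: "P = a + c"
    unfolding span_Un by blast
  have C: "?C \<subseteq> polyfuns" using Q_set_polyfuns by blast
  have "c = 0"
  proof (rule sobolev_orthogonal_span_eq_0[OF C _ _ c])
    show "sobolev_inner v w = 0" if "v \<in> ?C" "w \<in> ?C" "v \<noteq> w" for v w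
      using that sobolev_inner_Q_set(1) by fastforce
    show "sobolev_inner v v \<noteq> 0" if "v \<in> ?C" for v
      using that sobolev_inner_Q_set(2) by fastforce
    fix v assume v: "v \<in> ?C"
    then obtain m where m: "m < n" "v \<in> Q_set m" by blast
    then have "sobolev_inner P v = 0"
      using P Q_set_poly_space by (auto simp: orthogonal_space_def)
    moreover have "sobolev_inner a v = 0"
      by (rule sobolev_inner_span_zero[OF Q_set_polyfuns C _ a span_base[OF v]])
        (use sobolev_inner_Q_set(1) in fastforce)
    moreover have "c = (-1) *\<^sub>R a + P" by (simp add: Pac)
    moreover have "a \<in> polyfuns" "P \<in> polyfuns" "v \<in> polyfuns"
      using a v C span_subset_polyfuns[OF Q_set_polyfuns, of n] \<open>P \<in> poly_space n\<close> poly_space_subset_polyfuns by blast+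
    ultimately show "sobolev_inner c v = 0" by (simp only: sobolev_inner_linear_left)
  qed
  then show "P \<in> span (Q_set n)" using a by (simp add: Pac)
qed

lemma is_basis_family_Q: "is_basis_family (indices n) (\<lambda>(j, \<nu>). sobolev_Q Y n j \<nu>) (orthogonal_space n)"
  unfolding is_basis_family_def
proof (intro conjI)
  show "inj_on (\<lambda>(j, \<nu>). sobolev_Q Y n j \<nu>) (indices n)"
  proof (rule inj_onI)
    fix x y assume x: "x \<in> indices n" and y: "y \<in> indices n"
      and eq: "(case x of (j, \<nu>) \<Rightarrow> sobolev_Q Y n j \<nu>) = (case y of (j, \<nu>) \<Rightarrow> sobolev_Q Y n j \<nu>)"
    obtain i \<mu> j \<nu> where xy: "x = (i, \<mu>)" "y = (j, \<nu>)" by fastforce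
    show "x = y"
    proof (rule ccontr)
      assume "x \<noteq> y"
      then have "sobolev_inner (sobolev_Q Y n i \<mu>) (sobolev_Q Y n j \<nu>) = 0"
        using sobolev_inner_Q[of i \<mu> n j \<nu> n] x y xy by auto
      then have "sobolev_inner (sobolev_Q Y n i \<mu>) (sobolev_Q Y n i \<mu>) = 0"
        using eq xy by simp
      then show False
        using sobolev_inner_Q[of i \<mu> n i \<mu> n] x xy sobolev_norm_sq_pos[of "real CARD('d)" n i] by simp
    qed
  qed
  show "independent ((\<lambda>(j, \<nu>). sobolev_Q Y n j \<nu>) ` indices n)"
    unfolding Q_set_def[symmetric]
    by (rule sobolev_orthogonal_independent[OF Q_set_polyfuns]) (use sobolev_inner_Q_set in blast)+
  show "span ((\<lambda>(j, \<nu>). sobolev_Q Y n j \<nu>) ` indices n) = orthogonal_space n"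
    by (simp add: orthogonal_space_eq Q_set_def)
qed

end

theorem theorem2p4:
  fixes Y :: "nat \<Rightarrow> nat \<Rightarrow> real^'d::finite \<Rightarrow> real"
    and \<sigma> :: "nat \<Rightarrow> nat"
    and n :: nat
  assumes "\<And>m. \<sigma> m = dim (harmonic_space m :: (real^'d \<Rightarrow> real) set)"
    and "\<And>m. is_basis_family {1..\<sigma> m} (Y m) (harmonic_space m)"
    and "\<And>m \<mu> \<nu>. \<mu> \<in> {1..\<sigma> m} \<Longrightarrow> \<nu> \<in> {1..\<sigma> m} \<Longrightarrow>
           sphere_inner (Y m \<mu>) (Y m \<nu>) = (if \<mu> = \<nu> then 1 else 0)"
  shows
    "is_basis_family (SIGMA j:{0..n div 2}. {1..\<sigma> (n - 2 * j)})
        (\<lambda>(j, \<nu>). sobolev_Q Y n j \<nu>) (orthogonal_space n) \<and>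
     (\<forall>(i, \<mu>) \<in> (SIGMA j:{0..n div 2}. {1..\<sigma> (n - 2 * j)}).
      \<forall>(j, \<nu>) \<in> (SIGMA j:{0..n div 2}. {1..\<sigma> (n - 2 * j)}).
        (i, \<mu>) \<noteq> (j, \<nu>) \<longrightarrow> sobolev_inner (sobolev_Q Y n i \<mu>) (sobolev_Q Y n j \<nu>) = 0) \<and>
     (\<forall>\<nu>\<in>{1..\<sigma> n}.
        sobolev_inner (sobolev_Q Y n 0 \<nu>) (sobolev_Q Y n 0 \<nu>) =
          (2 * real n + real CARD('d)) / real CARD('d)) \<and>
     (\<forall>j\<in>{1..n div 2}. \<forall>\<nu>\<in>{1..\<sigma> (n - 2 * j)}.
        sobolev_inner (sobolev_Q Y n j \<nu>) (sobolev_Q Y n j \<nu>) =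
          2 * (real j)\<^sup>2 * (real j + 1)\<^sup>2 / (real CARD('d) * (real n + real CARD('d) / 2)))"
proof -
  interpret harmonic_basis Y \<sigma>
    by unfold_locales (use assms(2,3) in auto)
  show ?thesis
    unfolding indices_def[symmetric]
  proof (intro conjI)
    show "is_basis_family (indices n) (\<lambda>(j, \<nu>). sobolev_Q Y n j \<nu>) (orthogonal_space n)"
      by (rule is_basis_family_Q)
    show "\<forall>(i, \<mu>)\<in>indices n. \<forall>(j, \<nu>)\<in>indices n. (i, \<mu>) \<noteq> (j, \<nu>) \<longrightarrow>
        sobolev_inner (sobolev_Q Y n i \<mu>) (sobolev_Q Y n j \<nu>) = 0"
      by (auto simp: sobolev_inner_Q)
    show "\<forall>\<nu>\<in>{1..\<sigma> n}. sobolev_inner (sobolev_Q Y n 0 \<nu>) (sobolev_Q Y n 0 \<nu>) =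
        (2 * real n + real CARD('d)) / real CARD('d)"
    proof
      fix \<nu> assume "\<nu> \<in> {1..\<sigma> n}"
      then have "(0, \<nu>) \<in> indices n" by (simp add: indices_def)
      then show "sobolev_inner (sobolev_Q Y n 0 \<nu>) (sobolev_Q Y n 0 \<nu>) =
          (2 * real n + real CARD('d)) / real CARD('d)"
        by (simp add: sobolev_inner_Q sobolev_norm_sq_def)
    qed
    show "\<forall>j\<in>{1..n div 2}. \<forall>\<nu>\<in>{1..\<sigma> (n - 2 * j)}.
        sobolev_inner (sobolev_Q Y n j \<nu>) (sobolev_Q Y n j \<nu>) =
          2 * (real j)\<^sup>2 * (real j + 1)\<^sup>2 / (real CARD('d) * (real n + real CARD('d) / 2))"
    proof (intro ballI)
      fix j \<nu> assume j: "j \<in> {1..n div 2}" and "\<nu> \<in> {1..\<sigma> (n - 2 * j)}"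
      then have "(j, \<nu>) \<in> indices n" by (simp add: indices_def)
      then show "sobolev_inner (sobolev_Q Y n j \<nu>) (sobolev_Q Y n j \<nu>) =
          2 * (real j)\<^sup>2 * (real j + 1)\<^sup>2 / (real CARD('d) * (real n + real CARD('d) / 2))"
        using j by (simp add: sobolev_inner_Q sobolev_norm_sq_def)
    qed
  qed
qed

end
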